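(* Let $\mathcal{H}$ be a Hilbert $\mathcal{A}$-module over a unital $C^{*}$-algebra $\mathcal{A}$, let $C,C'\in GL^{+}(\mathcal{H})$, and let $\{T_i\}_{i\in I}\subset End_{\mathcal{A}}^{*}(\mathcal{H})$, where $I$ is a countable index set. Assume that $C$ and $C'$ commute with each other and with $T_i^{*}T_i$ for every $i\in I$, and that $\sum_{i\in I}\langle T_iCx,T_iC'x\rangle_{\mathcal{A}}$ converges in the norm of $\mathcal{A}$ for every $x\in\mathcal{H}$. Then $\{T_i\}_{i\in I}$ is a $(C,C')$-controlled $*$-operator frame for $End_{\mathcal{A}}^{*}(\mathcal{H})$ if and only if there exist strictly nonzero elements $A,B\in\mathcal{A}$ such that $$\|A^{-1}\|^{-2}\,\|\langle x,x\rangle_{\mathcal{A}}\|\le\Big\|\sum_{i\in I}\langle T_iCx,T_iC'x\rangle_{\mathcal{A}}\Big\|\le\|B\|^{2}\,\|\langle x,x\rangle_{\mathcal{A}}\|\qquad\text{for every }x\in\mathcal{H}.$$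
   Context: The $\mathcal{A}$-valued inner product $\langle\cdot,\cdot\rangle_{\mathcal{A}}$ of the (left) Hilbert $\mathcal{A}$-module $\mathcal{H}$ is $\mathcal{A}$-linear in the first variable. $End_{\mathcal{A}}^{*}(\mathcal{H})$ is the set of adjointable operators on $\mathcal{H}$. $GL^{+}(\mathcal{H})$ is the set of positive bounded linear invertible operators on $\mathcal{H}$ with bounded inverse. An element $a\in\mathcal{A}$ is strictly nonzero if $0$ is not in its spectrum, i.e. $a$ is invertible. Definition. For $C,C'\in GL^{+}(\mathcal{H})$, a family $\{T_i\}_{i\in I}$ of adjointable operators on $\mathcal{H}$ is a $(C,C')$-controlled $*$-operator frame for $End_{\mathcal{A}}^{*}(\mathcal{H})$ if there exist positive invertible elements $A,B\in\mathcal{A}$ such that $$A\langle x,x\rangle_{\mathcal{A}}A^{*}\le\sum_{i\in I}\langle T_iCx,T_iC'x\rangle_{\mathcal{A}}\le B\langle x,x\rangle_{\mathcal{A}}B^{*}\qquad\text{for all }x\in\mathcal{H};$$ $A$ and $B$ are called lower and upper bounds. The series is assumed to converge in norm. *)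

theory Defs
  imports "HOL-Analysis.Analysis"
begin

class complex_vector = real_vector +
  fixes scaleC :: "complex \<Rightarrow> 'a \<Rightarrow> 'a" (infixr "*\<^sub>C" 75)
  assumes scaleC_add_right: "c *\<^sub>C (x + y) = c *\<^sub>C x + c *\<^sub>C y"
    and scaleC_add_left: "(c + d) *\<^sub>C x = c *\<^sub>C x + d *\<^sub>C x"
    and scaleC_scaleC: "c *\<^sub>C d *\<^sub>C x = (c * d) *\<^sub>C x"
    and scaleC_one: "1 *\<^sub>C x = x"
    and scaleR_scaleC: "r *\<^sub>R x = complex_of_real r *\<^sub>C x"

class complex_normed_vector = complex_vector + real_normed_vector +
  assumes norm_scaleC: "norm (c *\<^sub>C x) = cmod c * norm x"

class complex_banach = complex_normed_vector + complete_space

class star =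
  fixes star :: "'a \<Rightarrow> 'a" ("_\<^sup>\<star>" [1000] 999)

class cstar_algebra = complex_banach + real_normed_algebra_1 + star +
  assumes mult_scaleC_left: "(c *\<^sub>C a) * b = c *\<^sub>C (a * b)"
    and mult_scaleC_right: "a * (c *\<^sub>C b) = c *\<^sub>C (a * b)"
    and star_add: "(a + b)\<^sup>\<star> = a\<^sup>\<star> + b\<^sup>\<star>"
    and star_scaleC: "(c *\<^sub>C a)\<^sup>\<star> = cnj c *\<^sub>C a\<^sup>\<star>"
    and star_mult: "(a * b)\<^sup>\<star> = b\<^sup>\<star> * a\<^sup>\<star>"
    and star_star: "(a\<^sup>\<star>)\<^sup>\<star> = a"
    and cstar_identity: "norm (a\<^sup>\<star> * a) = (norm a)\<^sup>2"

definition invertible_elem :: "'a::cstar_algebra \<Rightarrow> bool" where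
  "invertible_elem a \<longleftrightarrow> (\<exists>b. a * b = 1 \<and> b * a = 1)"

definition elem_inverse :: "'a::cstar_algebra \<Rightarrow> 'a" where
  "elem_inverse a = (THE b. a * b = 1 \<and> b * a = 1)"

definition spectrum :: "'a::cstar_algebra \<Rightarrow> complex set" where
  "spectrum a = {c. \<not> invertible_elem (c *\<^sub>C 1 - a)}"

definition strictly_nonzero :: "'a::cstar_algebra \<Rightarrow> bool" where
  "strictly_nonzero a \<longleftrightarrow> 0 \<notin> spectrum a"

definition positive_elem :: "'a::cstar_algebra \<Rightarrow> bool" where
  "positive_elem a \<longleftrightarrow> a\<^sup>\<star> = a \<and> spectrum a \<subseteq> \<real>\<^sub>\<ge>\<^sub>0"

definition cstar_le :: "'a::cstar_algebra \<Rightarrow> 'a \<Rightarrow> bool" (infix "\<preceq>" 50) where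
  "a \<preceq> b \<longleftrightarrow> positive_elem (b - a)"

text \<open>Completeness of the module is part of the class \<^class>\<open>complex_banach\<close>; the assumption
  \<open>norm_eq\<close> says that the norm of that class is the one induced by the inner product.\<close>

locale hilbert_module =
  fixes act :: "'a::cstar_algebra \<Rightarrow> 'h::complex_banach \<Rightarrow> 'h"
    and ip :: "'h \<Rightarrow> 'h \<Rightarrow> 'a"
  assumes act_add_right: "act a (x + y) = act a x + act a y"
    and act_add_left: "act (a + b) x = act a x + act b x"
    and act_mult: "act (a * b) x = act a (act b x)"
    and act_one: "act 1 x = x"
    and act_scaleC_left: "act (c *\<^sub>C a) x = c *\<^sub>C act a x"
    and act_scaleC_right: "act a (c *\<^sub>C x) = c *\<^sub>C act a x"
    and ip_positive: "positive_elem (ip x x)"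
    and ip_definite: "ip x x = 0 \<longleftrightarrow> x = 0"
    and ip_linear_left: "ip (act a x + y) z = a * ip x z + ip y z"
    and ip_star: "(ip x y)\<^sup>\<star> = ip y x"
    and norm_eq: "norm x = sqrt (norm (ip x x))"

definition adjointable ::
    "('h::complex_banach \<Rightarrow> 'h \<Rightarrow> 'a::cstar_algebra) \<Rightarrow> ('h \<Rightarrow> 'h) \<Rightarrow> bool" where
  "adjointable ip T \<longleftrightarrow> (\<exists>S. \<forall>x y. ip (T x) y = ip x (S y))"

definition adjoint_op ::
    "('h::complex_banach \<Rightarrow> 'h \<Rightarrow> 'a::cstar_algebra) \<Rightarrow> ('h \<Rightarrow> 'h) \<Rightarrow> 'h \<Rightarrow> 'h" where
  "adjoint_op ip T = (THE S. \<forall>x y. ip (T x) y = ip x (S y))"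

definition bounded_clinear :: "('h::complex_normed_vector \<Rightarrow> 'h) \<Rightarrow> bool" where
  "bounded_clinear T \<longleftrightarrow> bounded_linear T \<and> (\<forall>c x. T (c *\<^sub>C x) = c *\<^sub>C T x)"

text \<open>Adjointability (and hence module linearity) is not required separately of the elements
  of \<open>GL\<^sup>+\<close>: by polarization a complex-linear \<open>C\<close> with all \<open>ip (C x) x\<close> positive is
  its own adjoint.\<close>

definition GL_pos ::
    "('h::complex_banach \<Rightarrow> 'h \<Rightarrow> 'a::cstar_algebra) \<Rightarrow> ('h \<Rightarrow> 'h) set" where
  "GL_pos ip = {C. bounded_clinear C \<and> (\<forall>x. positive_elem (ip (C x) x)) \<and>
     bij C \<and> bounded_clinear (inv C)}"

text \<open>\<^const>\<open>summable_on\<close> and \<^const>\<open>infsum\<close> refer to norm convergence of the net of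
  finite partial sums, as no enumeration of the index set is given. For series of positive
  elements this agrees with norm convergence along any enumeration.\<close>

definition controlled_frame_bounds ::
    "('h::complex_banach \<Rightarrow> 'h \<Rightarrow> 'a::cstar_algebra) \<Rightarrow> ('h \<Rightarrow> 'h) \<Rightarrow> ('h \<Rightarrow> 'h) \<Rightarrow>
     'i set \<Rightarrow> ('i \<Rightarrow> 'h \<Rightarrow> 'h) \<Rightarrow> 'a \<Rightarrow> 'a \<Rightarrow> bool" where
  "controlled_frame_bounds ip C C' I T A B \<longleftrightarrow>
     (\<forall>x. A * ip x x * A\<^sup>\<star> \<preceq> (\<Sum>\<^sub>\<infinity>i\<in>I. ip (T i (C x)) (T i (C' x))) \<and>
          (\<Sum>\<^sub>\<infinity>i\<in>I. ip (T i (C x)) (T i (C' x))) \<preceq> B * ip x x * B\<^sup>\<star>)"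

definition controlled_star_operator_frame ::
    "('h::complex_banach \<Rightarrow> 'h \<Rightarrow> 'a::cstar_algebra) \<Rightarrow> ('h \<Rightarrow> 'h) \<Rightarrow> ('h \<Rightarrow> 'h) \<Rightarrow>
     'i set \<Rightarrow> ('i \<Rightarrow> 'h \<Rightarrow> 'h) \<Rightarrow> bool" where
  "controlled_star_operator_frame ip C C' I T \<longleftrightarrow>
     C \<in> GL_pos ip \<and> C' \<in> GL_pos ip \<and>
     (\<forall>i\<in>I. adjointable ip (T i)) \<and>
     (\<forall>x. (\<lambda>i. ip (T i (C x)) (T i (C' x))) summable_on I) \<and>
     (\<exists>A B. positive_elem A \<and> invertible_elem A \<and> positive_elem B \<and> invertible_elem B \<and>
        controlled_frame_bounds ip C C' I T A B)"

end

theory Submission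
  imports Defs
begin

text \<open>Write \<open>p x = \<langle>x, x\<rangle>\<close> and \<open>s x\<close> for the frame sum; both satisfy \<open>f (a x) = a (f x) a\<^sup>\<star>\<close>.
  If \<open>s\<close> is positive and \<open>\<parallel>s x\<parallel> \<le> M \<parallel>p x\<parallel>\<close> for all \<open>x\<close>, then \<open>s x \<le> M p x\<close>: replace \<open>x\<close> by
  \<open>(p x + \<epsilon>)^(-1/2) x\<close>, so that \<open>p\<close> becomes at most \<open>1\<close> and \<open>s\<close> at most \<open>M\<close>, conjugate back and let
  \<open>\<epsilon>\<close> tend to \<open>0\<close>.  The same argument with \<open>p\<close> and \<open>s\<close> exchanged gives the lower bound, so no frame
  operator is needed.  Positivity of \<open>s\<close> is the positivity of a product of commuting positive operators
  (Riesz' iteration \<open>D \<mapsto> D - D\<^sup>2\<close>).  The opposite implication is the monotonicity of the norm on the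
  positive cone.\<close>

subsection \<open>Complex scalar multiplication\<close>

subclass (in complex_banach) banach ..

lemma scaleC_zero_right [simp]: "c *\<^sub>C (0::'a::complex_vector) = 0"
  by (metis add_cancel_right_left scaleC_add_right)

lemma scaleC_zero_left [simp]: "0 *\<^sub>C (x::'a::complex_vector) = 0"
  by (metis add_cancel_right_left scaleC_add_left)

lemma scaleC_minus_right: "c *\<^sub>C (- x) = - (c *\<^sub>C (x::'a::complex_vector))"
  by (metis add.right_inverse add_eq_0_iff scaleC_add_right scaleC_zero_right)

lemma scaleC_minus_left: "(- c) *\<^sub>C x = - (c *\<^sub>C (x::'a::complex_vector))"
  by (metis add.right_inverse add_eq_0_iff scaleC_add_left scaleC_zero_left)

lemma scaleC_diff_right: "c *\<^sub>C (x - y) = c *\<^sub>C x - c *\<^sub>C (y::'a::complex_vector)"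
  using scaleC_add_right[of c x "- y"] by (simp add: scaleC_minus_right)

lemma scaleC_diff_left: "(c - d) *\<^sub>C x = c *\<^sub>C x - d *\<^sub>C (x::'a::complex_vector)"
  using scaleC_add_left[of c "- d" x] by (simp add: scaleC_minus_left)

subsection \<open>The involution\<close>

lemma star_zero [simp]: "(0::'a::cstar_algebra)\<^sup>\<star> = 0"
  by (metis add_cancel_right_left star_add)

lemma star_minus: "(- a)\<^sup>\<star> = - (a::'a::cstar_algebra)\<^sup>\<star>"
  by (metis add.right_inverse add_eq_0_iff star_add star_zero)

lemma star_diff: "(a - b)\<^sup>\<star> = a\<^sup>\<star> - (b::'a::cstar_algebra)\<^sup>\<star>"
  using star_add[of a "- b"] by (simp add: star_minus)

lemma star_one [simp]: "(1::'a::cstar_algebra)\<^sup>\<star> = 1"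
  by (metis mult.right_neutral star_mult star_star)

lemma star_scaleR: "(r *\<^sub>R a)\<^sup>\<star> = r *\<^sub>R (a::'a::cstar_algebra)\<^sup>\<star>"
  by (simp add: scaleR_scaleC star_scaleC)

lemma star_power: "(a ^ n)\<^sup>\<star> = ((a::'a::cstar_algebra)\<^sup>\<star>) ^ n"
  by (induction n) (simp_all add: star_mult power_commutes)

lemma norm_star: "norm (a\<^sup>\<star>) = norm (a::'a::cstar_algebra)"
proof -
  have *: "norm b \<le> norm (b\<^sup>\<star>)" for b :: 'a
  proof (cases "b = 0")
    case False
    have "norm b * norm b \<le> norm (b\<^sup>\<star>) * norm b"
      using cstar_identity[of b] norm_mult_ineq[of "b\<^sup>\<star>" b] by (simp add: power2_eq_square)
    then show ?thesis using False by simp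
  qed simp
  show ?thesis using *[of a] *[of "a\<^sup>\<star>"] by (simp add: star_star)
qed

lemma bounded_linear_star: "bounded_linear (star :: 'a::cstar_algebra \<Rightarrow> 'a)"
  by (rule bounded_linear_intro[of _ 1]) (simp_all add: star_add star_scaleR norm_star)

lemma norm_square_self_adjoint: "a\<^sup>\<star> = a \<Longrightarrow> norm (a * a) = (norm (a::'a::cstar_algebra))\<^sup>2"
  using cstar_identity[of a] by simp

text \<open>Each squaring of a self-adjoint power is an instance of the C*-identity; the spectral
  radius argument works with dyadic exponents.\<close>

lemma norm_dyadic_power:
  fixes a :: "'a::cstar_algebra"
  assumes "a\<^sup>\<star> = a"
  shows "norm (a ^ (2 ^ m)) = norm a ^ (2 ^ m)"
proof (induction m)
  case (Suc m)
  have "a ^ (2 ^ Suc m) = a ^ (2 ^ m) * a ^ (2 ^ m)"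
    by (simp add: mult_2 power_add)
  then show ?case
    using norm_square_self_adjoint[of "a ^ (2 ^ m)"] Suc assms
    by (simp add: star_power mult_2 power_add power2_eq_square)
qed simp

subsection \<open>Invertible elements\<close>

lemma invertible_elemI: "a * b = 1 \<Longrightarrow> b * a = 1 \<Longrightarrow> invertible_elem a"
  unfolding invertible_elem_def by blast

lemma elem_inverse_eqI:
  assumes "a * b = 1" "b * a = 1"
  shows "elem_inverse a = b"
  unfolding elem_inverse_def
proof (rule the_equality)
  show "c = b" if "a * c = 1 \<and> c * a = 1" for c
    by (metis assms(2) that mult.assoc mult_1_left mult_1_right)
qed (use assms in simp)

lemma
  assumes "invertible_elem a"
  shows elem_inverse_right: "a * elem_inverse a = 1"
    and elem_inverse_left: "elem_inverse a * a = 1"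
  using assms elem_inverse_eqI unfolding invertible_elem_def by metis+

lemma elem_inverse_nonzero: "invertible_elem a \<Longrightarrow> elem_inverse a \<noteq> 0"
  using elem_inverse_right by fastforce

lemma invertible_elem_inverse: "invertible_elem a \<Longrightarrow> invertible_elem (elem_inverse a)"
  using elem_inverse_left elem_inverse_right invertible_elemI by blast

lemma invertible_mult:
  assumes "invertible_elem a" "invertible_elem b"
  shows "invertible_elem (a * b)"
proof (rule invertible_elemI)
  show "a * b * (elem_inverse b * elem_inverse a) = 1"
    by (metis assms elem_inverse_right mult.assoc mult_1_left)
  show "elem_inverse b * elem_inverse a * (a * b) = 1"
    by (metis assms elem_inverse_left mult.assoc mult_1_left)
qed

lemma invertible_scaleC:
  assumes "invertible_elem a" "c \<noteq> 0"
  shows "invertible_elem (c *\<^sub>C a)"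
  by (rule invertible_elemI[of _ "inverse c *\<^sub>C elem_inverse a"])
    (simp_all add: assms mult_scaleC_left mult_scaleC_right scaleC_scaleC scaleC_one
      elem_inverse_left elem_inverse_right)

lemma invertible_scaleC_iff:
  assumes "c \<noteq> 0"
  shows "invertible_elem (c *\<^sub>C a) \<longleftrightarrow> invertible_elem a"
proof
  assume "invertible_elem (c *\<^sub>C a)"
  then show "invertible_elem a"
    using assms invertible_scaleC[of "c *\<^sub>C a" "inverse c"] by (simp add: scaleC_scaleC scaleC_one)
qed (use assms invertible_scaleC in blast)

lemma invertible_minus_iff: "invertible_elem (- a) \<longleftrightarrow> invertible_elem a"
  using invertible_scaleC_iff[of "-1" a] by (simp add: scaleC_minus_left scaleC_one)

lemma elem_inverse_self_adjoint:
  assumes "invertible_elem a" "a\<^sup>\<star> = a"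
  shows "(elem_inverse a)\<^sup>\<star> = elem_inverse a"
proof (rule elem_inverse_eqI[symmetric])
  show "a * (elem_inverse a)\<^sup>\<star> = 1"
    by (metis assms elem_inverse_left star_mult star_one)
  show "(elem_inverse a)\<^sup>\<star> * a = 1"
    by (metis assms elem_inverse_right star_mult star_one)
qed

section \<open>Neumann series and perturbation of inverses\<close>

lemma invertible_one_minus:
  fixes x :: "'a::cstar_algebra"
  assumes "norm x < 1"
  shows "invertible_elem (1 - x)"
proof -
  have sm: "summable (\<lambda>n. x ^ n)"
  proof (rule summable_norm_cancel, rule summable_comparison_test)
    show "\<exists>N. \<forall>n\<ge>N. norm (norm (x ^ n)) \<le> norm x ^ n"
      by (simp add: norm_power_ineq)
    show "summable (\<lambda>n. norm x ^ n)" using assms by (intro summable_geometric) simp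
  qed
  have split: "(\<Sum>n. x ^ n) = 1 + (\<Sum>n. x ^ Suc n)"
    using suminf_split_head[OF sm] by simp
  have "x * (\<Sum>n. x ^ n) = (\<Sum>n. x ^ Suc n)"
    using suminf_mult[OF sm, of x] by simp
  moreover have "(\<Sum>n. x ^ n) * x = (\<Sum>n. x ^ Suc n)"
    using suminf_mult2[OF sm, of x] by (simp add: power_commutes)
  ultimately show ?thesis
    using split by (intro invertible_elemI[of _ "\<Sum>n. x ^ n"]) (simp_all add: algebra_simps)
qed

text \<open>Write \<open>b = a * (1 - elem_inverse a * (a - b))\<close> and apply the Neumann series
  to the second factor.\<close>

lemma invertible_near:
  assumes "invertible_elem a" "norm (a - b) * norm (elem_inverse a) < 1"
  shows "invertible_elem b"
proof -
  let ?i = "elem_inverse a"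
  have "norm (?i * (a - b)) < 1"
    using norm_mult_ineq[of ?i "a - b"] assms(2) by (simp add: mult.commute)
  then have "invertible_elem (a * (1 - ?i * (a - b)))"
    using assms(1) invertible_mult invertible_one_minus by blast
  moreover have "a * (1 - ?i * (a - b)) = a - (a * ?i) * (a - b)"
    by (simp only: right_diff_distrib mult.assoc mult_1_right)
  ultimately show ?thesis by (simp add: elem_inverse_right assms(1))
qed

text \<open>Quantitative continuity of inversion, from the identity
  \<open>?j - ?i = ?j * (a - b) * ?i\<close>. The smallness hypothesis first yields
  \<open>norm ?j \<le> 2 * norm ?i\<close>.\<close>

lemma norm_elem_inverse_diff:
  assumes a: "invertible_elem a" and b: "invertible_elem b"
    and near: "norm (a - b) * norm (elem_inverse a) \<le> 1 / 2"
  shows "norm (elem_inverse a - elem_inverse b) \<le> 2 * (norm (elem_inverse a))\<^sup>2 * norm (a - b)"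
proof -
  let ?i = "elem_inverse a" and ?j = "elem_inverse b"
  have "?j * (a - b) * ?i = ?j * (a * ?i) - (?j * b) * ?i"
    by (simp add: algebra_simps)
  then have eq: "?j - ?i = ?j * (a - b) * ?i"
    by (simp add: elem_inverse_left elem_inverse_right a b)
  have "norm (?j * (a - b) * ?i) \<le> norm ?j * norm (a - b) * norm ?i"
    using norm_mult_ineq[of "?j * (a - b)" ?i] norm_mult_ineq[of ?j "a - b"]
    by (meson mult_right_mono norm_ge_zero order_trans)
  then have *: "norm (?j - ?i) \<le> norm ?j * (norm (a - b) * norm ?i)"
    unfolding eq by (simp add: mult.assoc)
  also have "\<dots> \<le> norm ?j * (1 / 2)"
    using near by (rule mult_left_mono) simp
  finally have "norm ?j \<le> 2 * norm ?i"
    using norm_triangle_ineq2[of ?j ?i] by linarith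
  then have "norm ?j * (norm (a - b) * norm ?i) \<le> 2 * norm ?i * (norm (a - b) * norm ?i)"
    by (intro mult_right_mono) auto
  then show ?thesis using * by (simp add: norm_minus_commute power2_eq_square mult_ac)
qed

subsection \<open>Spectra of self-adjoint elements\<close>

lemma spectrum_iff: "c \<in> spectrum a \<longleftrightarrow> \<not> invertible_elem (a - c *\<^sub>C 1)"
  unfolding spectrum_def using invertible_minus_iff[of "a - c *\<^sub>C 1"] by simp

lemma invertible_iff_spectrum: "invertible_elem a \<longleftrightarrow> 0 \<notin> spectrum a"
  by (simp add: spectrum_iff)

lemma norm_scaleC_one: "norm (c *\<^sub>C (1::'a::cstar_algebra)) = cmod c"
  by (simp add: norm_scaleC)

text \<open>\<open>c *\<^sub>C 1 - a\<close> is \<open>c\<close> times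
  \<open>1 - inverse c *\<^sub>C a\<close>, which a Neumann series inverts once
  \<open>norm a < cmod c\<close>.\<close>

lemma spectrum_norm_le:
  assumes "c \<in> spectrum a"
  shows "cmod c \<le> norm a"
proof (rule ccontr)
  assume "\<not> cmod c \<le> norm a"
  then have lt: "norm a < cmod c" and c0: "c \<noteq> 0" using norm_ge_zero[of a] by auto
  have "norm (inverse c *\<^sub>C a) < 1"
    using lt c0 by (simp add: norm_scaleC norm_inverse norm_divide field_simps)
  then have "invertible_elem (c *\<^sub>C (1 - inverse c *\<^sub>C a))"
    using c0 invertible_one_minus invertible_scaleC by blast
  moreover have "c *\<^sub>C (1 - inverse c *\<^sub>C a) = c *\<^sub>C 1 - a"
    using c0 by (simp add: scaleC_diff_right scaleC_scaleC scaleC_one)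
  ultimately show False using assms unfolding spectrum_def by simp
qed

lemma spectrum_shift: "c \<in> spectrum (a + d *\<^sub>C 1) \<longleftrightarrow> c - d \<in> spectrum a"
  by (simp add: spectrum_iff scaleC_diff_left algebra_simps)

lemma spectrum_minus_shift: "c \<in> spectrum (d *\<^sub>C 1 - a) \<longleftrightarrow> d - c \<in> spectrum a"
proof -
  have "d *\<^sub>C 1 - a - c *\<^sub>C 1 = - (a - (d - c) *\<^sub>C 1)"
    by (simp add: scaleC_diff_left)
  then show ?thesis unfolding spectrum_iff by (simp only: invertible_minus_iff)
qed

text \<open>Arens' argument: shifting by \<open>i n\<close> moves the spectrum linearly in \<open>n\<close>, while
  \<open>\<parallel>a + i n\<parallel>\<^sup>2 \<le> \<parallel>a\<parallel>\<^sup>2 + n\<^sup>2\<close>.\<close>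

lemma self_adjoint_spectrum_real:
  fixes a :: "'a::cstar_algebra"
  assumes sa: "a\<^sup>\<star> = a" and c: "c \<in> spectrum a"
  shows "Im c = 0"
proof -
  have bound: "(Im c + t)\<^sup>2 \<le> (norm a)\<^sup>2 + t\<^sup>2" for t :: real
  proof -
    let ?d = "\<i> * complex_of_real t"
    let ?b = "a + ?d *\<^sub>C 1"
    have "c + ?d \<in> spectrum ?b" using c by (simp add: spectrum_shift)
    then have 1: "cmod (c + ?d) \<le> norm ?b" by (rule spectrum_norm_le)
    have dd: "- (?d * ?d) = complex_of_real (t\<^sup>2)"
      by (simp add: power2_eq_square algebra_simps)
    have "?b\<^sup>\<star> * ?b = (a - ?d *\<^sub>C 1) * (a + ?d *\<^sub>C 1)"
      by (simp add: star_add star_scaleC sa scaleC_minus_left)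
    also have "\<dots> = a * a - (?d * ?d) *\<^sub>C 1"
      by (simp add: algebra_simps mult_scaleC_left mult_scaleC_right scaleC_scaleC
          scaleC_diff_right scaleC_minus_left)
    also have "\<dots> = a * a + (complex_of_real (t\<^sup>2)) *\<^sub>C 1"
      using scaleC_minus_left[of "?d * ?d" "1::'a"] dd by simp
    finally have "(norm ?b)\<^sup>2 = norm (a * a + (complex_of_real (t\<^sup>2)) *\<^sub>C 1)"
      by (metis cstar_identity)
    also have "\<dots> \<le> (norm a)\<^sup>2 + t\<^sup>2"
      using norm_triangle_ineq[of "a * a" "(complex_of_real (t\<^sup>2)) *\<^sub>C 1"]
      by (simp add: norm_scaleC norm_square_self_adjoint[OF sa] norm_power)
    finally have 2: "(norm ?b)\<^sup>2 \<le> (norm a)\<^sup>2 + t\<^sup>2" .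
    have "\<bar>Im c + t\<bar> \<le> norm ?b" using 1 abs_Im_le_cmod[of "c + ?d"] by simp
    then have "\<bar>Im c + t\<bar>\<^sup>2 \<le> (norm ?b)\<^sup>2" by (intro power_mono) auto
    with 2 show ?thesis by simp
  qed
  show ?thesis
  proof (rule ccontr)
    assume i0: "Im c \<noteq> 0"
    \<comment> \<open>This \<open>t\<close> makes the mixed term \<open>2 * Im c * t\<close> equal
      to \<open>(norm a)\<^sup>2\<close>, so the bound collapses to
      \<open>(Im c)\<^sup>2 \<le> 0\<close>.\<close>
    define t where "t = (norm a)\<^sup>2 / (2 * Im c)"
    have "(Im c)\<^sup>2 + 2 * Im c * t \<le> (norm a)\<^sup>2"
      using bound[of t] by (simp add: power2_sum)
    then have "(Im c)\<^sup>2 \<le> 0" using i0 by (simp add: t_def)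
    with i0 show False by simp
  qed
qed

section \<open>Spectral radius of self-adjoint elements\<close>

lemma continuous_on_resolvent:
  fixes a :: "'a::cstar_algebra"
  assumes inv: "\<And>z. z \<in> S \<Longrightarrow> invertible_elem (1 - z *\<^sub>C a)"
  shows "continuous_on S (\<lambda>z. elem_inverse (1 - z *\<^sub>C a))"
  unfolding continuous_on_iff
proof (intro ballI allI impI)
  fix z :: complex and e :: real assume z: "z \<in> S" and e: "e > 0"
  define M where "M = norm (elem_inverse (1 - z *\<^sub>C a))"
  define K where "K = norm a + 1"
  have M: "M > 0" using elem_inverse_nonzero[OF inv[OF z]] by (simp add: M_def)
  have K: "K > 0" using norm_ge_zero[of a] by (simp add: K_def add_nonneg_pos)
  \<comment> \<open>The first entry secures the smallness hypothesis of
    \<open>norm_elem_inverse_diff\<close>; the second turns its estimate into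
    \<open>e / 2\<close>.\<close>
  define d where "d = min (1 / (2 * K * M)) (e / (4 * M\<^sup>2 * K))"
  have d: "d > 0" using M K e by (simp add: d_def)
  show "\<exists>d>0. \<forall>w\<in>S. dist w z < d \<longrightarrow>
      dist (elem_inverse (1 - w *\<^sub>C a)) (elem_inverse (1 - z *\<^sub>C a)) < e"
  proof (intro exI[of _ d] conjI ballI impI d)
    fix w assume w: "w \<in> S" "dist w z < d"
    have "norm ((1 - z *\<^sub>C a) - (1 - w *\<^sub>C a)) = norm ((w - z) *\<^sub>C a)"
      by (simp add: scaleC_diff_left)
    then have "norm ((1 - z *\<^sub>C a) - (1 - w *\<^sub>C a)) = cmod (w - z) * norm a"
      by (simp add: norm_scaleC)
    also have "\<dots> \<le> d * K"
      using w K d by (intro mult_mono) (auto simp: dist_norm K_def)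
    finally have le: "norm ((1 - z *\<^sub>C a) - (1 - w *\<^sub>C a)) \<le> d * K" .
    have "d * K * M \<le> 1 / (2 * K * M) * K * M"
      using M K by (intro mult_right_mono) (auto simp: d_def)
    also have "\<dots> = 1 / 2" using M K by (simp add: field_simps)
    finally have dM: "d * K * M \<le> 1 / 2" .
    have near: "norm ((1 - z *\<^sub>C a) - (1 - w *\<^sub>C a)) * M \<le> 1 / 2"
      using mult_right_mono[OF le, of M] M dM by linarith
    have "norm (elem_inverse (1 - z *\<^sub>C a) - elem_inverse (1 - w *\<^sub>C a))
        \<le> 2 * M\<^sup>2 * norm ((1 - z *\<^sub>C a) - (1 - w *\<^sub>C a))"
      using norm_elem_inverse_diff[OF inv[OF z] inv[OF w(1)]] near by (simp add: M_def)
    also have "\<dots> \<le> 2 * M\<^sup>2 * (d * K)"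
      using le by (intro mult_left_mono) auto
    also have "\<dots> \<le> 2 * M\<^sup>2 * (e / (4 * M\<^sup>2 * K) * K)"
      using K by (intro mult_left_mono mult_right_mono) (auto simp: d_def)
    also have "\<dots> = e / 2" using M K by (simp add: field_simps)
    also have "\<dots> < e" using e by simp
    finally show "dist (elem_inverse (1 - w *\<^sub>C a)) (elem_inverse (1 - z *\<^sub>C a)) < e"
      by (simp add: dist_norm norm_minus_commute)
  qed
qed

text \<open>Partial fractions for \<open>1 - b * b = (1 - b) * (1 + b)\<close>. This is the
  averaging step for the resolvents below.\<close>

lemma elem_inverse_one_minus_square:
  fixes b :: "'a::cstar_algebra"
  assumes m: "invertible_elem (1 - b)" and p: "invertible_elem (1 + b)"
  shows "invertible_elem (1 - b * b)"
    and "elem_inverse (1 - b * b) = (1 / 2) *\<^sub>R (elem_inverse (1 - b) + elem_inverse (1 + b))"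
proof -
  let ?m = "elem_inverse (1 - b)" and ?p = "elem_inverse (1 + b)"
  have "(1 - b * b) * ?m = (1 + b) * ((1 - b) * ?m)"
    by (simp add: algebra_simps)
  then have 1: "(1 - b * b) * ?m = 1 + b" by (simp add: elem_inverse_right m)
  have "(1 - b * b) * ?p = (1 - b) * ((1 + b) * ?p)"
    by (simp add: algebra_simps)
  then have 2: "(1 - b * b) * ?p = 1 - b" by (simp add: elem_inverse_right p)
  have "?m * (1 - b * b) = (?m * (1 - b)) * (1 + b)"
    by (simp add: algebra_simps)
  then have 3: "?m * (1 - b * b) = 1 + b" by (simp add: elem_inverse_left m)
  have "?p * (1 - b * b) = (?p * (1 + b)) * (1 - b)"
    by (simp add: algebra_simps)
  then have 4: "?p * (1 - b * b) = 1 - b" by (simp add: elem_inverse_left p)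
  have half: "(1 / 2) *\<^sub>R (1 + b + (1 - b)) = (1::'a)"
    by (simp flip: scaleR_2)
  have r: "(1 - b * b) * ((1 / 2) *\<^sub>R (?m + ?p)) = 1"
    using half by (simp add: distrib_left 1 2)
  have l: "((1 / 2) *\<^sub>R (?m + ?p)) * (1 - b * b) = 1"
    using half by (simp add: distrib_right 3 4)
  show "invertible_elem (1 - b * b)" using r l by (rule invertible_elemI)
  show "elem_inverse (1 - b * b) = (1 / 2) *\<^sub>R (?m + ?p)"
    using r l by (rule elem_inverse_eqI)
qed

text \<open>If \<open>z\<close> ranges over the
  disc of radius \<open>1 / \<parallel>a\<parallel>\<close>, averaging resolvents over the \<open>2^m\<close>-th roots of unity expresses
  \<open>(1 - (z a)^(2^m))\<inverse>\<close> through \<open>(1 - z a)\<inverse>\<close> without losing the modulus of continuity.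
  Inside the disc these inverses converge to \<open>1\<close>, so they get close to \<open>1\<close> on the boundary, which
  contradicts \<open>\<parallel>(z a)^(2^m)\<parallel> = 1\<close>.\<close>

lemma self_adjoint_norm_le_spectral_radius:
  fixes a :: "'a::cstar_algebra"
  assumes sa: "a\<^sup>\<star> = a" and r: "r \<ge> 0" and sp: "\<And>c. c \<in> spectrum a \<Longrightarrow> cmod c \<le> r"
  shows "norm a \<le> r"
proof (rule ccontr)
  assume "\<not> norm a \<le> r"
  then have ra: "r < norm a" by simp
  define \<rho> where "\<rho> = 1 / norm a"
  have a0: "norm a > 0" using ra r by linarith
  have \<rho>: "\<rho> > 0" using a0 by (simp add: \<rho>_def)
  define D where "D = cball (0::complex) \<rho>"
  define b where "b m z = z ^ (2 ^ m) *\<^sub>C a ^ (2 ^ m)" for m :: nat and z :: complex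
  define F where "F m z = elem_inverse (1 - b m z)" for m z
  have inv0: "invertible_elem (1 - z *\<^sub>C a)" if z: "z \<in> D" for z
  proof (cases "z = 0")
    case True
    then show ?thesis by (simp add: invertible_elemI[of 1 1])
  next
    case False
    \<comment> \<open>For nonzero \<open>z\<close> in the disc, \<open>1 / z\<close> has modulus at
      least \<open>norm a\<close>, which exceeds \<open>r\<close>, so it lies outside the
      spectrum.\<close>
    have "cmod z \<le> \<rho>" using z by (simp add: D_def)
    then have "norm a \<le> cmod (1 / z)"
      using False a0 by (simp add: \<rho>_def norm_divide field_simps)
    then have "1 / z \<notin> spectrum a" using sp[of "1 / z"] ra by linarith
    then have "invertible_elem (z *\<^sub>C ((1 / z) *\<^sub>C 1 - a))"
      using False by (simp add: spectrum_def invertible_scaleC)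
    then show ?thesis
      using False by (simp add: scaleC_diff_right scaleC_scaleC scaleC_one)
  qed
  have "continuous_on D (\<lambda>z. elem_inverse (1 - z *\<^sub>C a))"
    using inv0 by (rule continuous_on_resolvent)
  then have "uniformly_continuous_on D (\<lambda>z. elem_inverse (1 - z *\<^sub>C a))"
    by (intro compact_uniformly_continuous) (auto simp: D_def)
  then obtain d where d: "d > 0" and unif: "\<And>z w. z \<in> D \<Longrightarrow> w \<in> D \<Longrightarrow> dist w z < d \<Longrightarrow>
      dist (elem_inverse (1 - w *\<^sub>C a)) (elem_inverse (1 - z *\<^sub>C a)) < 1 / 8"
    unfolding uniformly_continuous_on_def by (metis zero_less_divide_1_iff zero_less_numeral)
  \<comment> \<open>Shrinking by \<open>t\<close> moves points of \<open>D\<close> by at most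
    \<open>d / 2\<close>, within reach of the uniform continuity; the maximum keeps \<open>t\<close>
    nonnegative when \<open>d\<close> is large.\<close>
  define t where "t = max 0 (1 - d / (2 * \<rho>))"
  have t: "0 \<le> t" "t < 1" and t\<rho>: "(1 - t) * \<rho> < d"
    using \<rho> d by (auto simp: t_def max_def field_simps split: if_splits)
  have scaled: "complex_of_real t * z \<in> D" if "z \<in> D" for z
  proof -
    have "t * cmod z \<le> 1 * cmod z" using t by (intro mult_right_mono) auto
    then show ?thesis using that t by (simp add: D_def norm_mult)
  qed
  have step: "(\<forall>z\<in>D. invertible_elem (1 - b m z)) \<and>
      (\<forall>z\<in>D. norm (F m z - F m (complex_of_real t * z)) \<le> 1 / 8)" for m
  proof (induction m)
    case 0
    have "norm (F 0 z - F 0 (complex_of_real t * z)) \<le> 1 / 8" if z: "z \<in> D" for z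
    proof -
      have "z - complex_of_real t * z = complex_of_real (1 - t) * z" by (simp add: algebra_simps)
      then have "dist z (complex_of_real t * z) = (1 - t) * cmod z"
        using t by (simp add: dist_norm norm_mult del: of_real_diff)
      also have "\<dots> \<le> (1 - t) * \<rho>" using z t by (intro mult_left_mono) (auto simp: D_def)
      finally have "dist z (complex_of_real t * z) < d" using t\<rho> by linarith
      from unif[OF scaled[OF z] z this] show ?thesis by (simp add: F_def b_def dist_norm)
    qed
    then show ?case using inv0 by (simp add: b_def)
  next
    case (Suc m)
    \<comment> \<open>Multiplication by \<open>\<omega>\<close> preserves the disc and flips the
      sign of \<open>b m z\<close>, so \<open>F (Suc m) z\<close> is the mean of
      \<open>F m z\<close> and \<open>F m (\<omega> * z)\<close> and the bound \<open>1 / 8\<close>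
      survives.\<close>
    define \<omega> where "\<omega> = cis (pi / 2 ^ m)"
    have \<omega>: "\<omega> ^ (2 ^ m) = -1" by (simp add: \<omega>_def Complex.DeMoivre)
    have neg: "b m (\<omega> * z) = - b m z" for z
      by (simp add: b_def power_mult_distrib \<omega> scaleC_minus_left)
    have sq: "b (Suc m) z = b m z * b m z" for z
      by (simp add: b_def mult_scaleC_left mult_scaleC_right scaleC_scaleC mult_2 power_add)
    have \<omega>D: "\<omega> * z \<in> D" if "z \<in> D" for z
      using that by (simp add: D_def norm_mult \<omega>_def)
    have m: "invertible_elem (1 - b m z)" if "z \<in> D" for z using Suc that by blast
    have p: "invertible_elem (1 + b m z)" if "z \<in> D" for z
      using m[OF \<omega>D[OF that]] neg[of z] by simp
    have F: "F (Suc m) z = (1 / 2) *\<^sub>R (F m z + F m (\<omega> * z))" if "z \<in> D" for z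
      using elem_inverse_one_minus_square(2)[OF m[OF that] p[OF that]] neg[of z]
      by (simp add: F_def sq)
    have "norm (F (Suc m) z - F (Suc m) (complex_of_real t * z)) \<le> 1 / 8" if z: "z \<in> D" for z
    proof -
      let ?tz = "complex_of_real t * z"
      have "F (Suc m) z - F (Suc m) ?tz
          = (1 / 2) *\<^sub>R ((F m z - F m ?tz) + (F m (\<omega> * z) - F m (complex_of_real t * (\<omega> * z))))"
        using F[OF z] F[OF scaled[OF z]] by (simp add: algebra_simps)
      moreover have "norm (F m z - F m ?tz) \<le> 1 / 8" using Suc z by blast
      moreover have "norm (F m (\<omega> * z) - F m (complex_of_real t * (\<omega> * z))) \<le> 1 / 8"
        using Suc \<omega>D[OF z] by blast
      ultimately show ?thesis
        using norm_triangle_ineq[of "F m z - F m ?tz"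
            "F m (\<omega> * z) - F m (complex_of_real t * (\<omega> * z))"] by simp
    qed
    then show ?case using elem_inverse_one_minus_square(1)[OF m p] by (simp add: sq)
  qed
  have norm_b: "norm (b m (complex_of_real s)) = (s / \<rho>) ^ (2 ^ m)" if "s \<ge> 0" for m s
    using that by (simp add: b_def norm_scaleC norm_power norm_dyadic_power[OF sa] \<rho>_def
        power_mult_distrib)
  have "(\<lambda>n. t ^ n) \<longlonglongrightarrow> 0" using t by (intro LIMSEQ_power_zero) auto
  then obtain n where n: "\<And>k. k \<ge> n \<Longrightarrow> t ^ k < 1 / 16"
    using order_tendstoD(2)[of "\<lambda>n. t ^ n" 0 sequentially "1 / 16"]
    by (auto simp: eventually_sequentially)
  have small: "t ^ (2 ^ n) < 1 / 16" by (rule n) (simp add: less_imp_le)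
  \<comment> \<open>\<open>x\<close> is an interior value, small for this \<open>n\<close>, while
    the boundary value \<open>y\<close> has norm 1; the inverses of \<open>1 - x\<close> and
    \<open>1 - y\<close> are still within \<open>1 / 8\<close>.\<close>
  define x where "x = b n (complex_of_real (t * \<rho>))"
  define y where "y = b n (complex_of_real \<rho>)"
  have x: "norm x < 1 / 16" using small \<rho> t norm_b[of "t * \<rho>" n] by (simp add: x_def del: of_real_mult)
  have y: "norm y = 1" using \<rho> by (simp add: y_def norm_b)
  have \<rho>D: "complex_of_real \<rho> \<in> D" using \<rho> by (simp add: D_def)
  have invy: "invertible_elem (1 - y)" and invx: "invertible_elem (1 - x)"
    using step[of n] \<rho>D scaled[OF \<rho>D] by (auto simp: x_def y_def)
  have close: "norm (elem_inverse (1 - y) - elem_inverse (1 - x)) \<le> 1 / 8"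
    using step[of n] \<rho>D by (auto simp: x_def y_def F_def)
  have one: "elem_inverse (1::'a) = 1" by (rule elem_inverse_eqI) auto
  have "norm (elem_inverse 1 - elem_inverse (1 - x)) \<le> 2 * (norm (elem_inverse (1::'a)))\<^sup>2 * norm x"
    using norm_elem_inverse_diff[OF _ invx, of 1] x by (simp add: one invertible_elemI[of 1 1])
  then have "norm (1 - elem_inverse (1 - x)) \<le> 1 / 8" using x by (simp add: one)
  with close have G: "norm (elem_inverse (1 - y) - 1) \<le> 1 / 4"
    using norm_triangle_ineq4[of "elem_inverse (1 - y) - elem_inverse (1 - x)"
        "1 - elem_inverse (1 - x)"] by simp
  \<comment> \<open>Since \<open>1 - y\<close> has norm at most 2, this identity bounds the norm of
    \<open>y\<close> by \<open>1 / 2\<close>, whereas it is 1.\<close>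
  have "(elem_inverse (1 - y) - 1) * (1 - y) = y"
    using elem_inverse_left[OF invy] by (simp add: left_diff_distrib)
  then have "norm y \<le> norm (elem_inverse (1 - y) - 1) * norm (1 - y)"
    by (metis norm_mult_ineq)
  also have "\<dots> \<le> 1 / 4 * 2"
    using G y norm_triangle_ineq4[of 1 y] by (intro mult_mono) auto
  finally show False using y by simp
qed

subsection \<open>The positive cone\<close>

lemma positive_elem_star: "positive_elem a \<Longrightarrow> a\<^sup>\<star> = a"
  by (simp add: positive_elem_def)

lemma positive_elem_spectrum:
  assumes "positive_elem a" "c \<in> spectrum a"
  shows "0 \<le> Re c" and "Re c \<le> norm a" and "c = complex_of_real (Re c)"
proof -
  show "0 \<le> Re c" using assms by (auto simp: positive_elem_def complex_nonneg_Reals_iff)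
  show "Re c \<le> norm a"
    using spectrum_norm_le[OF assms(2)] complex_Re_le_cmod[of c] by linarith
  show "c = complex_of_real (Re c)"
    using assms by (auto simp: positive_elem_def complex_nonneg_Reals_iff complex_eq_iff)
qed

text \<open>The spectrum of a self-adjoint element is real, so only the negative numbers
  \<open>- \<mu>\<close> remain to be excluded.\<close>

lemma positive_elemI:
  fixes a :: "'a::cstar_algebra"
  assumes "a\<^sup>\<star> = a" "\<And>\<mu>. \<mu> > 0 \<Longrightarrow> invertible_elem (a + \<mu> *\<^sub>R 1)"
  shows "positive_elem a"
proof -
  have "0 \<le> Re c \<and> Im c = 0" if c: "c \<in> spectrum a" for c
  proof -
    have im: "Im c = 0" using assms(1) c by (rule self_adjoint_spectrum_real)
    then have "c = complex_of_real (Re c)" by (simp add: complex_eq_iff)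
    then have "\<not> invertible_elem (a - complex_of_real (Re c) *\<^sub>C 1)"
      using c spectrum_iff by metis
    then have "\<not> invertible_elem (a + (- Re c) *\<^sub>R 1)"
      by (simp add: scaleR_scaleC scaleC_minus_left)
    then have "\<not> - Re c > 0" using assms(2) by blast
    with im show ?thesis by simp
  qed
  then show ?thesis using assms(1) by (auto simp: positive_elem_def complex_nonneg_Reals_iff)
qed

text \<open>The spectrum of \<open>t *\<^sub>R 1 - a\<close> lies between 0 and \<open>t\<close>,
  and the spectral radius bounds the norm. With the converse below, positivity becomes a norm
  inequality, from which the cone is seen to be convex and closed.\<close>

lemma norm_shift_positive_le:
  fixes a :: "'a::cstar_algebra"
  assumes a: "positive_elem a" and t: "norm a \<le> t"
  shows "norm (t *\<^sub>R 1 - a) \<le> t"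
proof (rule self_adjoint_norm_le_spectral_radius)
  show "(t *\<^sub>R 1 - a)\<^sup>\<star> = t *\<^sub>R 1 - a"
    using a by (simp add: star_diff star_scaleR positive_elem_star)
  show "t \<ge> 0" using t norm_ge_zero[of a] by linarith
  fix c assume "c \<in> spectrum (t *\<^sub>R 1 - a)"
  then have c: "complex_of_real t - c \<in> spectrum a"
    by (simp add: scaleR_scaleC spectrum_minus_shift)
  have "complex_of_real t - c = complex_of_real (t - Re c)"
    using positive_elem_spectrum(3)[OF a c] by simp
  then have "c = complex_of_real (Re c)" by (simp add: algebra_simps)
  then have "cmod c = \<bar>Re c\<bar>" by (metis norm_of_real)
  then show "cmod c \<le> t"
    using positive_elem_spectrum(1,2)[OF a c] t by simp
qed

text \<open>Every spectral value \<open>c\<close> of \<open>a\<close> satisfies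
  \<open>cmod (t - c) \<le> t\<close>, which excludes negative real parts.\<close>

lemma positive_elem_if_norm_shift:
  fixes a :: "'a::cstar_algebra"
  assumes sa: "a\<^sup>\<star> = a" and t: "norm (t *\<^sub>R 1 - a) \<le> t"
  shows "positive_elem a"
proof -
  have "0 \<le> Re c \<and> Im c = 0" if c: "c \<in> spectrum a" for c
  proof -
    have "complex_of_real t - c \<in> spectrum (t *\<^sub>R 1 - a)"
      using c by (simp add: scaleR_scaleC spectrum_minus_shift)
    then have "cmod (complex_of_real t - c) \<le> t" using spectrum_norm_le t order_trans by blast
    then have "t - Re c \<le> t"
      using complex_Re_le_cmod[of "complex_of_real t - c"] by simp
    then show ?thesis using self_adjoint_spectrum_real[OF sa c] by simp
  qed
  then show ?thesis using sa by (auto simp: positive_elem_def complex_nonneg_Reals_iff)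
qed

text \<open>Shifting by the sum of the norms reduces the claim to the triangle inequality.\<close>

lemma positive_elem_add:
  fixes a b :: "'a::cstar_algebra"
  assumes a: "positive_elem a" and b: "positive_elem b"
  shows "positive_elem (a + b)"
proof (rule positive_elem_if_norm_shift[where t = "norm a + norm b"])
  show "(a + b)\<^sup>\<star> = a + b" using a b by (simp add: star_add positive_elem_star)
  have eq: "(norm a + norm b) *\<^sub>R 1 - (a + b) = (norm a *\<^sub>R 1 - a) + (norm b *\<^sub>R 1 - b)"
    by (simp add: algebra_simps)
  show "norm ((norm a + norm b) *\<^sub>R 1 - (a + b)) \<le> norm a + norm b"
    unfolding eq using norm_triangle_ineq[of "norm a *\<^sub>R 1 - a" "norm b *\<^sub>R 1 - b"]
      norm_shift_positive_le[OF a order_refl] norm_shift_positive_le[OF b order_refl] by linarith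
qed

lemma positive_elem_zero: "positive_elem 0"
  by (rule positive_elem_if_norm_shift[of _ 0]) auto

lemma positive_elem_one: "positive_elem 1"
  by (rule positive_elem_if_norm_shift[of _ 1]) auto

lemma positive_elem_scaleR:
  fixes a :: "'a::cstar_algebra"
  assumes a: "positive_elem a" and r: "r \<ge> 0"
  shows "positive_elem (r *\<^sub>R a)"
proof (rule positive_elem_if_norm_shift[where t = "r * norm a"])
  show "(r *\<^sub>R a)\<^sup>\<star> = r *\<^sub>R a" using a by (simp add: star_scaleR positive_elem_star)
  have "(r * norm a) *\<^sub>R 1 - r *\<^sub>R a = r *\<^sub>R (norm a *\<^sub>R 1 - a)"
    by (simp add: algebra_simps)
  then show "norm ((r * norm a) *\<^sub>R 1 - r *\<^sub>R a) \<le> r * norm a"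
    using norm_shift_positive_le[OF a order_refl] r by (simp add: mult_left_mono)
qed

lemma positive_elem_sum:
  fixes f :: "'i \<Rightarrow> 'a::cstar_algebra"
  assumes "\<And>i. i \<in> F \<Longrightarrow> positive_elem (f i)"
  shows "positive_elem (sum f F)"
  using assms
  by (induction F rule: infinite_finite_induct) (auto intro: positive_elem_zero positive_elem_add)

text \<open>A convergent sequence is bounded, so one shift \<open>t\<close> serves all its members
  and the norm criterion passes to the limit.\<close>

lemma closed_positive_elem: "closed {a::'a::cstar_algebra. positive_elem a}"
  unfolding closed_sequential_limits
proof (intro allI impI, elim conjE)
  fix f and l :: 'a
  assume pos: "\<forall>n. f n \<in> {a. positive_elem a}" and lim: "f \<longlonglongrightarrow> l"
  obtain t where t: "\<And>n. norm (f n) \<le> t"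
    using convergent_imp_Bseq[OF convergentI[OF lim]] by (auto simp: Bseq_def)
  have "(\<lambda>n. (f n)\<^sup>\<star>) \<longlonglongrightarrow> l\<^sup>\<star>"
    using bounded_linear.tendsto[OF bounded_linear_star lim] .
  moreover have "(\<lambda>n. (f n)\<^sup>\<star>) = f" using pos by (auto simp: positive_elem_star)
  ultimately have sa: "l\<^sup>\<star> = l" using lim LIMSEQ_unique by metis
  have "(\<lambda>n. norm (t *\<^sub>R 1 - f n)) \<longlonglongrightarrow> norm (t *\<^sub>R 1 - l)"
    using lim by (intro tendsto_intros)
  then have "norm (t *\<^sub>R 1 - l) \<le> t"
    by (rule LIMSEQ_le_const2) (use pos t norm_shift_positive_le in blast)
  with sa show "l \<in> {a. positive_elem a}" using positive_elem_if_norm_shift by blast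
qed

lemma positive_elem_tendsto:
  fixes f :: "'b \<Rightarrow> 'a::cstar_algebra"
  assumes "(f \<longlongrightarrow> l) F" "F \<noteq> bot" "\<forall>\<^sub>F x in F. positive_elem (f x)"
  shows "positive_elem l"
  using Lim_in_closed_set[OF closed_positive_elem, of f F l] assms by auto

section \<open>Squares, monotonicity of the norm, conjugation\<close>

lemma positive_elem_square:
  fixes a :: "'a::cstar_algebra"
  assumes sa: "a\<^sup>\<star> = a"
  shows "positive_elem (a * a)"
proof (rule positive_elemI)
  show "(a * a)\<^sup>\<star> = a * a" using sa by (simp add: star_mult)
  fix \<mu> :: real assume \<mu>: "\<mu> > 0"
  \<comment> \<open>\<open>a * a + \<mu> *\<^sub>R 1\<close> factors into the shifts of
    \<open>a\<close> by \<open>?k\<close> and \<open>- ?k\<close>, which are invertible because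
    \<open>a\<close> has real spectrum.\<close>
  let ?k = "\<i> * complex_of_real (sqrt \<mu>)"
  have "?k \<notin> spectrum a" "- ?k \<notin> spectrum a"
    using self_adjoint_spectrum_real[OF sa, of ?k] self_adjoint_spectrum_real[OF sa, of "- ?k"] \<mu>
    by auto
  then have "invertible_elem ((a - ?k *\<^sub>C 1) * (a + ?k *\<^sub>C 1))"
    by (intro invertible_mult) (auto simp: spectrum_iff scaleC_minus_left)
  moreover have "?k * ?k = - complex_of_real \<mu>"
    using \<mu> by (simp add: algebra_simps flip: of_real_mult)
  then have "(a - ?k *\<^sub>C 1) * (a + ?k *\<^sub>C 1) = a * a + \<mu> *\<^sub>R 1"
    by (simp add: algebra_simps mult_scaleC_left mult_scaleC_right scaleC_scaleC
        scaleC_diff_right scaleC_minus_left scaleR_scaleC)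
  ultimately show "invertible_elem (a * a + \<mu> *\<^sub>R 1)" by simp
qed

lemma positive_elem_norm_diff:
  fixes a :: "'a::cstar_algebra"
  assumes sa: "a\<^sup>\<star> = a" and t: "norm a \<le> t"
  shows "positive_elem (t *\<^sub>R 1 - a)"
  using assms
  by (intro positive_elem_if_norm_shift[where t = t]) (simp_all add: star_diff star_scaleR)

lemma norm_le_if_positive_diff:
  fixes a :: "'a::cstar_algebra"
  assumes a: "positive_elem a" and d: "positive_elem (t *\<^sub>R 1 - a)" and t: "t \<ge> 0"
  shows "norm a \<le> t"
proof (rule self_adjoint_norm_le_spectral_radius)
  show "a\<^sup>\<star> = a" using a by (rule positive_elem_star)
  fix c assume c: "c \<in> spectrum a"
  then have "complex_of_real t - c \<in> spectrum (t *\<^sub>R 1 - a)"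
    by (simp add: scaleR_scaleC spectrum_minus_shift)
  then have "0 \<le> t - Re c" using positive_elem_spectrum(1)[OF d] by fastforce
  moreover have "cmod c = \<bar>Re c\<bar>" using positive_elem_spectrum(3)[OF a c] by (metis norm_of_real)
  ultimately show "cmod c \<le> t" using positive_elem_spectrum(1)[OF a c] by simp
qed (rule t)

text \<open>Both \<open>norm b *\<^sub>R 1 - b\<close> and \<open>b - a\<close> are positive, so
  \<open>a\<close> is dominated by the scalar \<open>norm b\<close>.\<close>

lemma norm_mono_positive:
  fixes a b :: "'a::cstar_algebra"
  assumes a: "positive_elem a" and ba: "a \<preceq> b"
  shows "norm a \<le> norm b"
proof (rule norm_le_if_positive_diff[OF a])
  have d: "positive_elem (b - a)" using ba by (simp add: cstar_le_def)
  have "positive_elem b" using positive_elem_add[OF d a] by simp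
  then have "positive_elem (norm b *\<^sub>R 1 - b)"
    by (simp add: positive_elem_norm_diff positive_elem_star)
  from positive_elem_add[OF this d] show "positive_elem (norm b *\<^sub>R 1 - a)" by simp
qed simp

text \<open>Invertibility keeps the spectrum of \<open>g\<close> away from 0, so some
  \<open>\<delta> *\<^sub>R 1\<close> can be split off with \<open>g - \<delta> *\<^sub>R 1\<close>
  still positive. Then \<open>r + g\<close> is a positive element plus
  \<open>\<delta> *\<^sub>R 1\<close>.\<close>

lemma invertible_add_positive:
  fixes r g :: "'a::cstar_algebra"
  assumes r: "positive_elem r" and g: "positive_elem g" and inv: "invertible_elem g"
  shows "invertible_elem (r + g)"
proof -
  \<comment> \<open>Shifts of \<open>g\<close> by at most this much stay invertible by
    \<open>invertible_near\<close>, with a factor 2 to spare.\<close>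
  define \<delta> where "\<delta> = 1 / (2 * norm (elem_inverse g))"
  have \<delta>: "\<delta> > 0" using elem_inverse_nonzero[OF inv] by (simp add: \<delta>_def)
  have "positive_elem (g - \<delta> *\<^sub>R 1)"
  proof (rule positive_elemI)
    show "(g - \<delta> *\<^sub>R 1)\<^sup>\<star> = g - \<delta> *\<^sub>R 1"
      using g by (simp add: star_diff star_scaleR positive_elem_star)
    fix \<mu> :: real assume \<mu>: "\<mu> > 0"
    have eq: "g - \<delta> *\<^sub>R 1 + \<mu> *\<^sub>R 1 = g - complex_of_real (\<delta> - \<mu>) *\<^sub>C 1"
      by (simp add: scaleR_diff_left del: of_real_diff flip: scaleR_scaleC)
    show "invertible_elem (g - \<delta> *\<^sub>R 1 + \<mu> *\<^sub>R 1)"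
    proof (cases "\<delta> < \<mu>")
      case True
      then have "complex_of_real (\<delta> - \<mu>) \<notin> spectrum g"
        using positive_elem_spectrum(1)[OF g, of "complex_of_real (\<delta> - \<mu>)"] by auto
      then show ?thesis unfolding eq spectrum_iff by blast
    next
      case False
      have "(\<delta> - \<mu>) * norm (elem_inverse g) \<le> \<delta> * norm (elem_inverse g)"
        using \<mu> by (intro mult_right_mono) auto
      also have "\<dots> = 1 / 2" using elem_inverse_nonzero[OF inv] by (simp add: \<delta>_def)
      finally show ?thesis
        unfolding eq using False
        by (intro invertible_near[OF inv]) (simp add: norm_scaleC_one del: of_real_diff)
    qed
  qed
  from positive_elem_add[OF r this]
  have "complex_of_real (- \<delta>) \<notin> spectrum (r + (g - \<delta> *\<^sub>R 1))"
    using positive_elem_spectrum(1) \<delta> by fastforce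
  moreover have "r + (g - \<delta> *\<^sub>R 1) - complex_of_real (- \<delta>) *\<^sub>C 1 = r + g"
    by (simp add: scaleR_scaleC scaleC_minus_left)
  ultimately show ?thesis by (simp add: spectrum_iff del: of_real_minus)
qed

text \<open>\<open>s * r * s + \<mu> *\<^sub>R 1\<close> is the conjugate by \<open>s\<close> of
  \<open>r + \<mu> *\<^sub>R (?i * ?i)\<close>, a positive element plus an invertible positive
  one.\<close>

lemma positive_elem_conjugate:
  fixes r s :: "'a::cstar_algebra"
  assumes r: "positive_elem r" and s: "s\<^sup>\<star> = s" and inv: "invertible_elem s"
  shows "positive_elem (s * r * s)"
proof (rule positive_elemI)
  show "(s * r * s)\<^sup>\<star> = s * r * s"
    using r s by (simp add: star_mult positive_elem_star mult.assoc)
  fix \<mu> :: real assume \<mu>: "\<mu> > 0"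
  let ?i = "elem_inverse s"
  have "positive_elem (\<mu> *\<^sub>R (?i * ?i))"
    using \<mu> elem_inverse_self_adjoint[OF inv s]
    by (intro positive_elem_scaleR positive_elem_square) auto
  moreover have "invertible_elem (\<mu> *\<^sub>R (?i * ?i))"
    unfolding scaleR_scaleC using \<mu> inv
    by (intro invertible_scaleC invertible_mult invertible_elem_inverse) auto
  ultimately have "invertible_elem (s * (r + \<mu> *\<^sub>R (?i * ?i)) * s)"
    using r inv by (intro invertible_mult invertible_add_positive)
  moreover have "s * (r + \<mu> *\<^sub>R (?i * ?i)) * s = s * r * s + \<mu> *\<^sub>R ((s * ?i) * (?i * s))"
    by (simp add: algebra_simps)
  ultimately show "invertible_elem (s * r * s + \<mu> *\<^sub>R 1)"
    using inv by (simp add: elem_inverse_left elem_inverse_right)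
qed

text \<open>Up to scaling, \<open>p + \<epsilon> = 1 - x\<close> with \<open>\<parallel>x\<parallel> < 1\<close>, and \<open>1 - y\<close> is a square root
  of \<open>1 - x\<close> iff \<open>y\<close> is a fixed point of the contraction \<open>y \<mapsto> (x + y\<^sup>2) / 2\<close>.\<close>

lemma positive_shift_square_root:
  fixes p :: "'a::cstar_algebra"
  assumes p: "positive_elem p" and e: "\<epsilon> > 0"
  obtains s where "s\<^sup>\<star> = s" "invertible_elem s" "s * s = p + \<epsilon> *\<^sub>R 1"
proof -
  define t where "t = norm p + \<epsilon>"
  have t: "t > 0" using e by (simp add: t_def add_nonneg_pos)
  \<comment> \<open>Chosen so that \<open>t *\<^sub>R (1 - x) = p + \<epsilon> *\<^sub>R 1\<close>;
    the summand \<open>\<epsilon>\<close> in \<open>t\<close> forces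
    \<open>norm x < 1\<close>.\<close>
  define x where "x = (1 / t) *\<^sub>R (norm p *\<^sub>R 1 - p)"
  have "norm x \<le> norm p / t"
    using norm_shift_positive_le[OF p order_refl] t by (simp add: x_def divide_right_mono)
  also have "\<dots> < 1" using e t by (simp add: t_def)
  finally have x1: "norm x < 1" .
  have sax: "x\<^sup>\<star> = x" using p by (simp add: x_def star_scaleR star_diff positive_elem_star)
  \<comment> \<open>Restricting to self-adjoint elements makes the fixed point self-adjoint; the
    radius \<open>norm x\<close> is also the contraction constant.\<close>
  define S where "S = cball (0::'a) (norm x) \<inter> {y. y\<^sup>\<star> = y}"
  define f where "f y = (1 / 2) *\<^sub>R (x + y * y)" for y
  have "closed {y::'a. y\<^sup>\<star> = y}"
    by (intro closed_Collect_eq linear_continuous_on bounded_linear_star continuous_on_id)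
  then have "closed S" by (auto simp: S_def)
  then have "complete S" by (simp add: complete_eq_closed)
  moreover have "S \<noteq> {}" using sax by (auto simp: S_def)
  moreover have "f ` S \<subseteq> S"
  proof
    fix z assume "z \<in> f ` S"
    then obtain y where y: "norm y \<le> norm x" "y\<^sup>\<star> = y" and z: "z = f y" by (auto simp: S_def)
    have "norm y * norm y \<le> 1 * norm x" using y x1 by (intro mult_mono) auto
    then have "norm (x + y * y) \<le> 2 * norm x"
      using norm_triangle_ineq[of x "y * y"] norm_mult_ineq[of y y] by linarith
    then show "z \<in> S"
      using y sax by (simp add: S_def z f_def star_scaleR star_add star_mult)
  qed
  moreover have "\<forall>y\<in>S. \<forall>z\<in>S. dist (f y) (f z) \<le> norm x * dist y z"
  proof (intro ballI)
    fix y z assume "y \<in> S" "z \<in> S"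
    then have yz: "norm y \<le> norm x" "norm z \<le> norm x" by (auto simp: S_def)
    have "f y - f z = (1 / 2) *\<^sub>R (y * (y - z) + (y - z) * z)"
      by (simp add: f_def algebra_simps)
    moreover have "norm (y * (y - z)) \<le> norm x * norm (y - z)"
      using norm_mult_ineq yz(1) by (meson mult_right_mono norm_ge_zero order_trans)
    moreover have "norm ((y - z) * z) \<le> norm x * norm (y - z)"
      using norm_mult_ineq[of "y - z" z] mult_left_mono[OF yz(2), of "norm (y - z)"]
      by (simp add: mult.commute)
    ultimately show "dist (f y) (f z) \<le> norm x * dist y z"
      using norm_triangle_ineq[of "y * (y - z)" "(y - z) * z"] by (simp add: dist_norm)
  qed
  ultimately have "\<exists>!y\<in>S. f y = y"
    using x1 by (intro Banach_fix) auto
  then obtain y where y: "y \<in> S" "f y = y" by blast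
  define s where "s = sqrt t *\<^sub>R (1 - y)"
  have "y\<^sup>\<star> = y" and y1: "norm y < 1" using y x1 by (auto simp: S_def)
  then have "s\<^sup>\<star> = s" by (simp add: s_def star_scaleR star_diff)
  moreover have "invertible_elem s"
    unfolding s_def scaleR_scaleC using t y1
    by (intro invertible_scaleC invertible_one_minus) auto
  moreover have "s * s = p + \<epsilon> *\<^sub>R 1"
  proof -
    have "x + y * y = 2 *\<^sub>R y" using arg_cong[OF y(2), of "\<lambda>v. 2 *\<^sub>R v"] by (simp add: f_def)
    then have "(1 - y) * (1 - y) = 1 - x" by (simp add: algebra_simps scaleR_2)
    then have "s * s = t *\<^sub>R (1 - x)" using t by (simp add: s_def)
    also have "\<dots> = p + \<epsilon> *\<^sub>R 1" using t by (simp add: x_def scaleR_diff_right) (simp add: t_def algebra_simps)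
    finally show ?thesis .
  qed
  ultimately show thesis by (rule that)
qed

text \<open>Stated for abstract forms so that the inner product and the frame sum can take either
  role, and forms \<open>ip (D x) x\<close> are covered too.\<close>

lemma form_dominated_if_norm_dominated:
  fixes act :: "'a::cstar_algebra \<Rightarrow> 'h \<Rightarrow> 'h" and p q :: "'h \<Rightarrow> 'a"
  assumes p: "\<And>x. positive_elem (p x)" and q: "\<And>x. positive_elem (q x)"
    and p_act: "\<And>a x. p (act a x) = a * p x * a\<^sup>\<star>"
    and q_act: "\<And>a x. q (act a x) = a * q x * a\<^sup>\<star>"
    and le: "\<And>x. norm (q x) \<le> M * norm (p x)" and M: "M \<ge> 0"
  shows "q x \<preceq> M *\<^sub>R p x"
proof -
  have approx: "positive_elem (M *\<^sub>R p x - q x + (M * \<epsilon>) *\<^sub>R 1)" if e: "\<epsilon> > 0" for \<epsilon>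
  proof -
    obtain s where s: "s\<^sup>\<star> = s" "invertible_elem s" "s * s = p x + \<epsilon> *\<^sub>R 1"
      using positive_shift_square_root[OF p e] by blast
    define a where "a = elem_inverse s"
    have a: "a\<^sup>\<star> = a" using s elem_inverse_self_adjoint by (simp add: a_def)
    have sa: "s * a = 1" "a * s = 1"
      using s by (simp_all add: a_def elem_inverse_left elem_inverse_right)
    have "a * p x * a = a * (s * s - \<epsilon> *\<^sub>R 1) * a" by (simp add: s(3))
    also have "\<dots> = (a * s) * (s * a) - \<epsilon> *\<^sub>R (a * a)" by (simp add: algebra_simps)
    finally have pa: "p (act a x) = 1 - \<epsilon> *\<^sub>R (a * a)" by (simp add: p_act a sa)
    have "positive_elem (\<epsilon> *\<^sub>R (a * a))"
      using e a by (intro positive_elem_scaleR positive_elem_square) auto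
    then have "norm (p (act a x)) \<le> 1"
      using p[of "act a x"] by (intro norm_le_if_positive_diff) (simp_all add: pa)
    then have "norm (q (act a x)) \<le> M"
      using le[of "act a x"] mult_left_mono[OF _ M, of "norm (p (act a x))" 1] by linarith
    then have "positive_elem (M *\<^sub>R 1 - q (act a x))"
      using q positive_elem_norm_diff positive_elem_star by blast
    \<comment> \<open>Conjugation by \<open>s\<close> undoes \<open>a\<close> and turns
      \<open>M *\<^sub>R 1\<close> into \<open>M *\<^sub>R (s * s)\<close>, which accounts for the
      error term \<open>(M * \<epsilon>) *\<^sub>R 1\<close>.\<close>
    then have "positive_elem (s * (M *\<^sub>R 1 - a * q x * a) * s)"
      using s positive_elem_conjugate by (simp add: q_act a)
    moreover have "s * (M *\<^sub>R 1 - a * q x * a) * s = M *\<^sub>R (s * s) - (s * a) * q x * (a * s)"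
      by (simp add: algebra_simps)
    ultimately show ?thesis by (simp add: s(3) sa algebra_simps)
  qed
  have "(\<lambda>n. M *\<^sub>R p x - q x + (M * inverse (real (Suc n))) *\<^sub>R 1)
      \<longlonglongrightarrow> M *\<^sub>R p x - q x + (M * 0) *\<^sub>R 1"
    by (intro tendsto_intros LIMSEQ_inverse_real_of_nat)
  then show ?thesis
    unfolding cstar_le_def using approx
    by (intro positive_elem_tendsto[where F = sequentially]) (auto intro!: always_eventually)
qed

subsection \<open>Symmetric operators on Hilbert modules\<close>

primrec riesz_iterate :: "('h::ab_group_add \<Rightarrow> 'h) \<Rightarrow> nat \<Rightarrow> 'h \<Rightarrow> 'h" where
  "riesz_iterate D 0 = D"
| "riesz_iterate D (Suc k) = (\<lambda>x. riesz_iterate D k x - riesz_iterate D k (riesz_iterate D k x))"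

context hilbert_module
begin

section \<open>Calculus of the algebra-valued inner product\<close>

lemma ip_add_left: "ip (x + y) z = ip x z + ip y z"
  using ip_linear_left[of 1 x y z] by (simp add: act_one)

lemma ip_zero_left [simp]: "ip 0 z = 0"
  using ip_add_left[of 0 0 z] by simp

lemma ip_act_left: "ip (act a x) z = a * ip x z"
  using ip_linear_left[of a x 0 z] by simp

lemma ip_scaleC_left: "ip (c *\<^sub>C x) z = c *\<^sub>C ip x z"
proof -
  have "c *\<^sub>C x = act (c *\<^sub>C 1) x" by (simp add: act_scaleC_left act_one)
  then show ?thesis by (simp add: ip_act_left mult_scaleC_left)
qed

lemma ip_minus_left: "ip (- x) z = - ip x z"
  using ip_scaleC_left[of "-1" x z] by (simp add: scaleC_minus_left scaleC_one)

lemma ip_diff_left: "ip (x - y) z = ip x z - ip y z"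
  using ip_add_left[of x "- y" z] by (simp add: ip_minus_left)

lemma ip_scaleR_left: "ip (r *\<^sub>R x) z = r *\<^sub>R ip x z"
  by (simp add: scaleR_scaleC ip_scaleC_left)

lemma ip_add_right: "ip z (x + y) = ip z x + ip z y"
  by (metis ip_star ip_add_left star_add)

lemma ip_zero_right [simp]: "ip z 0 = 0"
  by (metis ip_star ip_zero_left star_zero)

lemma ip_act_right: "ip z (act a x) = ip z x * a\<^sup>\<star>"
  by (metis ip_star ip_act_left star_mult)

lemma ip_scaleC_right: "ip z (c *\<^sub>C x) = cnj c *\<^sub>C ip z x"
  by (metis ip_star ip_scaleC_left star_scaleC)

lemma ip_diff_right: "ip z (x - y) = ip z x - ip z y"
  by (metis ip_star ip_diff_left star_diff)

lemma ip_scaleR_right: "ip z (r *\<^sub>R x) = r *\<^sub>R ip z x"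
  by (simp add: scaleR_scaleC ip_scaleC_right)

lemma ip_act_act: "ip (act a x) (act a x) = a * ip x x * a\<^sup>\<star>"
  by (simp add: ip_act_left ip_act_right mult.assoc)

lemma norm_ip_self: "norm (ip x x) = (norm x)\<^sup>2"
  by (simp add: norm_eq)

lemma ip_right_cancel: "(\<And>y. ip x y = ip z y) \<Longrightarrow> x = z"
  using ip_definite[of "x - z"] by (simp add: ip_diff_left)

lemma ip_left_cancel: "(\<And>x. ip x y = ip x z) \<Longrightarrow> y = z"
  using ip_definite[of "y - z"] by (simp add: ip_diff_right)

text \<open>Polarization gives Cauchy--Schwarz up to a constant, which is all that is needed.\<close>

lemma norm_ip_le: "norm (ip x y) \<le> 4 * norm x * norm y"
proof -
  have unit: "norm (ip u v) \<le> 4" if u: "norm u = 1" and v: "norm v = 1" for u v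
  proof -
    have B: "norm (c *\<^sub>C ip (u + d *\<^sub>C v) (u + d *\<^sub>C v)) \<le> 4"
      if "cmod c = 1" "cmod d = 1" for c d
    proof -
      have "norm (u + d *\<^sub>C v) \<le> 2"
        using norm_triangle_ineq[of u "d *\<^sub>C v"] u v that by (simp add: norm_scaleC)
      then have "(norm (u + d *\<^sub>C v))\<^sup>2 \<le> 2\<^sup>2" by (intro power_mono) auto
      then show ?thesis using that by (simp add: norm_scaleC norm_ip_self)
    qed
    \<comment> \<open>Over the four fourth roots of unity both \<open>c\<close> and
      \<open>c * c\<close> sum to zero, so only \<open>ip u v\<close> survives in the sum of the
      \<open>?t c\<close>, with factor 4.\<close>
    let ?t = "\<lambda>c. c *\<^sub>C ip (u + c *\<^sub>C v) (u + c *\<^sub>C v)"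
    have t: "?t c = c *\<^sub>C ip u u + ip u v + (c * c) *\<^sub>C ip v u + c *\<^sub>C ip v v"
      if "c * cnj c = 1" for c
      using that
      by (simp add: ip_add_left ip_add_right ip_scaleC_left ip_scaleC_right scaleC_add_right
          scaleC_scaleC scaleC_one algebra_simps)
    have unimodular: "1 * cnj 1 = 1" "(-1) * cnj (-1) = 1" "\<i> * cnj \<i> = 1" "(-\<i>) * cnj (-\<i>) = 1"
      by simp_all
    have four: "4 *\<^sub>R w = w + w + w + w" for w :: 'a
      using scaleR_add_left[of 2 2 w] by (simp add: scaleR_2 add.assoc)
    have "4 *\<^sub>R ip u v = ?t 1 + ?t (-1) + ?t \<i> + ?t (-\<i>)"
      unfolding unimodular[THEN t] by (simp add: scaleC_minus_left scaleC_one four)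
    then have "4 * norm (ip u v) = norm (?t 1 + ?t (-1) + ?t \<i> + ?t (-\<i>))"
      by (metis norm_scaleR abs_numeral)
    also have "\<dots> \<le> norm (?t 1) + norm (?t (-1)) + norm (?t \<i>) + norm (?t (-\<i>))"
      by (intro norm_triangle_mono order_refl)
    also have "\<dots> \<le> 16" using B[of 1 1] B[of "-1" "-1"] B[of \<i> \<i>] B[of "-\<i>" "-\<i>"] by simp
    finally show ?thesis by simp
  qed
  show ?thesis
  proof (cases "x = 0 \<or> y = 0")
    case False
    have "norm (ip ((1 / norm x) *\<^sub>R x) ((1 / norm y) *\<^sub>R y)) \<le> 4"
      using False by (intro unit) auto
    then show ?thesis using False by (simp add: ip_scaleR_left ip_scaleR_right field_simps)
  qed auto
qed

section \<open>Symmetric and positive operators, Riesz iteration\<close>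

definition symmetric_op :: "('h \<Rightarrow> 'h) \<Rightarrow> bool" where
  "symmetric_op D \<longleftrightarrow> (\<forall>x y. ip (D x) y = ip x (D y))"

definition positive_op :: "('h \<Rightarrow> 'h) \<Rightarrow> bool" where
  "positive_op D \<longleftrightarrow> (\<forall>x. positive_elem (ip (D x) x))"

lemma symmetric_opD: "symmetric_op D \<Longrightarrow> ip (D x) y = ip x (D y)"
  by (simp add: symmetric_op_def)

lemma positive_opD: "positive_op D \<Longrightarrow> positive_elem (ip (D x) x)"
  by (simp add: positive_op_def)

text \<open>A map with an adjoint inherits linearity from the first slot of \<open>ip\<close>, since
  elements are determined by their inner products. This gives adjointable and symmetric operators
  their module linearity.\<close>

lemma
  assumes "\<And>x y. ip (T x) y = ip x (S y)"
  shows adjoint_imp_diff: "T (x - z) = T x - T z"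
    and adjoint_imp_act: "T (act a x) = act a (T x)"
    and adjoint_imp_scaleR: "T (r *\<^sub>R x) = r *\<^sub>R T x"
  by (rule ip_right_cancel, simp add: assms ip_diff_left ip_act_left ip_scaleR_left)+

lemma symmetric_op_diff: "symmetric_op D \<Longrightarrow> D (x - z) = D x - D z"
  by (metis adjoint_imp_diff symmetric_opD)

lemma symmetric_op_scaleR: "symmetric_op D \<Longrightarrow> D (r *\<^sub>R x) = r *\<^sub>R D x"
  by (metis adjoint_imp_scaleR symmetric_opD)

lemma symmetric_op_act: "symmetric_op D \<Longrightarrow> D (act a x) = act a (D x)"
  by (metis adjoint_imp_act symmetric_opD)

text \<open>Positivity rests on \<open>E - E\<^sup>2 = E (1 - E) E + (1 - E) E (1 - E)\<close>, the
  upper bound on \<open>1 - (E - E\<^sup>2) = (1 - E) + E\<^sup>2\<close>.\<close>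

lemma riesz_iterate_properties:
  assumes "symmetric_op D" "positive_op D" "\<And>x. ip (D x) x \<preceq> ip x x"
  shows "symmetric_op (riesz_iterate D k) \<and> positive_op (riesz_iterate D k) \<and>
    (\<forall>x. ip (riesz_iterate D k x) x \<preceq> ip x x)"
proof (induction k)
  case (Suc k)
  define E where "E = riesz_iterate D k"
  have E: "symmetric_op E" "positive_op E" and E1: "\<And>x. positive_elem (ip x x - ip (E x) x)"
    using Suc by (auto simp: E_def cstar_le_def)
  have sym: "ip (E x) y = ip x (E y)" for x y using E(1) by (rule symmetric_opD)
  have 1: "ip (E x - E (E x)) y = ip x (E y - E (E y))" for x y
    by (simp add: ip_diff_left ip_diff_right sym)
  have 2: "positive_elem (ip (E x - E (E x)) x)" for x
  proof -
    have "ip (E x - E (E x)) x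
        = (ip (E x) (E x) - ip (E (E x)) (E x)) + ip (E (x - E x)) (x - E x)"
      by (simp add: ip_diff_left ip_diff_right symmetric_op_diff[OF E(1)])
    then show ?thesis using E1[of "E x"] positive_opD[OF E(2)] positive_elem_add by metis
  qed
  have 3: "positive_elem (ip x x - ip (E x - E (E x)) x)" for x
  proof -
    have "ip x x - ip (E x - E (E x)) x = (ip x x - ip (E x) x) + ip (E x) (E x)"
      by (simp add: ip_diff_left ip_diff_right sym[of "E x" x])
    then show ?thesis using E1[of x] ip_positive positive_elem_add by metis
  qed
  show ?case
    using 1 2 3 by (simp add: symmetric_op_def positive_op_def cstar_le_def flip: E_def)
qed (use assms in simp)

text \<open>With \<open>E\<^sub>k = riesz_iterate D k\<close> the telescoping sum \<open>D = \<Sum>k<n. E\<^sub>k\<^sup>2 + E\<^sub>n\<close> has decreasing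
  summands, whence \<open>n E\<^sub>n\<^sup>2 \<le> D\<close>.  Bounded sums of positive elements of a C*-algebra need not
  converge in norm, so monotonicity is essential here.\<close>

lemma riesz_iterate_norm_bound:
  assumes D: "symmetric_op D" "positive_op D" "\<And>x. ip (D x) x \<preceq> ip x x"
  shows "real n * (norm (riesz_iterate D n x))\<^sup>2 \<le> norm (ip (D x) x)"
proof -
  let ?E = "\<lambda>n. riesz_iterate D n x"
  note iter = riesz_iterate_properties[OF D]
  have decr: "positive_elem (ip (?E n) (?E n) - ip (?E (Suc n)) (?E (Suc n)))" for n
  proof -
    define E where "E = riesz_iterate D n"
    define y where "y = E x"
    have sym: "ip (E u) v = ip u (E v)" for u v
      using iter[of n] by (simp add: E_def symmetric_op_def)
    \<comment> \<open>In operator terms, \<open>1 - (1 - E)\<^sup>2 = E + (E - E\<^sup>2)\<close>,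
      and both summands are positive iterates.\<close>
    have "ip y y - ip (y - E y) (y - E y)
        = ip (E y) y + ip (riesz_iterate D (Suc n) y) y"
      by (simp add: ip_diff_left ip_diff_right sym flip: E_def)
    moreover have "positive_elem (ip (E y) y)" "positive_elem (ip (riesz_iterate D (Suc n) y) y)"
      using iter[of n] iter[of "Suc n"] unfolding E_def positive_op_def by blast+
    ultimately have "positive_elem (ip y y - ip (y - E y) (y - E y))"
      using positive_elem_add by metis
    then show ?thesis by (simp add: y_def E_def)
  qed
  have main: "positive_elem (ip (D x) x - ip (?E n) x - real n *\<^sub>R ip (?E n) (?E n))" for n
  proof (induction n)
    case 0
    then show ?case by (simp add: positive_elem_zero)
  next
    case (Suc n)
    have "ip (riesz_iterate D n (?E n)) x = ip (?E n) (?E n)"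
      using iter[of n] by (simp add: symmetric_op_def)
    then have "ip (?E (Suc n)) x = ip (?E n) x - ip (?E n) (?E n)"
      by (simp add: ip_diff_left)
    \<comment> \<open>Passing to the next iterate frees one more copy of
      \<open>ip (?E n) (?E n)\<close>; all \<open>Suc n\<close> copies are then replaced by the
      smaller next square.\<close>
    then have eq: "ip (D x) x - ip (?E (Suc n)) x - real (Suc n) *\<^sub>R ip (?E (Suc n)) (?E (Suc n))
        = (ip (D x) x - ip (?E n) x - real n *\<^sub>R ip (?E n) (?E n))
          + real (Suc n) *\<^sub>R (ip (?E n) (?E n) - ip (?E (Suc n)) (?E (Suc n)))"
      by (simp add: algebra_simps del: riesz_iterate.simps)
    show ?case
      unfolding eq by (rule positive_elem_add[OF Suc positive_elem_scaleR[OF decr]]) simp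
  qed
  have "positive_elem (ip (?E n) x)" using iter[of n] by (simp add: positive_op_def)
  from positive_elem_add[OF main[of n] this]
  have "real n *\<^sub>R ip (?E n) (?E n) \<preceq> ip (D x) x" by (simp add: cstar_le_def algebra_simps)
  from norm_mono_positive[OF positive_elem_scaleR[OF ip_positive] this]
  show ?thesis by (simp add: norm_ip_self)
qed

text \<open>\<open>D\<close> minus an iterate is a sum of squares \<open>E\<^sup>2\<close> of
  iterates commuting with \<open>P\<close>, and \<open>P E\<^sup>2 = E P E\<close> is positive. The
  remainder tends to 0 pointwise and the positive cone is closed.\<close>

lemma positive_op_compose_contraction:
  assumes D: "symmetric_op D" "positive_op D" "\<And>x. ip (D x) x \<preceq> ip x x"
    and P: "symmetric_op P" "positive_op P" and comm: "\<And>x. P (D x) = D (P x)"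
  shows "positive_op (\<lambda>x. P (D x))"
  unfolding positive_op_def
proof
  fix x
  let ?E = "riesz_iterate D"
  note iter = riesz_iterate_properties[OF D]
  have commE: "P (?E n y) = ?E n (P y)" for n y
    by (induction n arbitrary: y) (simp_all add: comm symmetric_op_diff[OF P(1)])
  have pos: "positive_elem (ip (D x - ?E n x) (P x))" for n
  proof (induction n)
    case 0
    then show ?case by (simp add: positive_elem_zero)
  next
    case (Suc n)
    have "ip (?E n (?E n x)) (P x) = ip (?E n x) (P (?E n x))"
      using iter[of n] by (simp add: symmetric_op_def commE)
    also have "\<dots> = ip (P (?E n x)) (?E n x)" using P(1) by (simp add: symmetric_op_def)
    finally have "positive_elem (ip (?E n (?E n x)) (P x))"
      using positive_opD[OF P(2)] by simp
    moreover have "ip (D x - ?E (Suc n) x) (P x)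
        = ip (D x - ?E n x) (P x) + ip (?E n (?E n x)) (P x)"
      by (simp add: ip_diff_left)
    ultimately show ?case using positive_elem_add[OF Suc] by simp
  qed
  define K where "K = norm (ip (D x) x)"
  have "(\<lambda>n. norm (?E n x)) \<longlonglongrightarrow> 0"
  proof (rule tendsto_sandwich[of "\<lambda>n. 0"])
    show "\<forall>\<^sub>F n in sequentially. norm (?E n x) \<le> sqrt (K / real n)"
    proof (rule eventually_mono[OF eventually_gt_at_top[of 0]])
      fix n :: nat assume "n > 0"
      then have "(norm (?E n x))\<^sup>2 \<le> K / real n"
        using riesz_iterate_norm_bound[OF D, of n x] by (simp add: K_def field_simps)
      then show "norm (?E n x) \<le> sqrt (K / real n)" by (rule real_le_rsqrt)
    qed
    show "(\<lambda>n. sqrt (K / real n)) \<longlonglongrightarrow> 0"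
      using tendsto_real_sqrt[OF lim_const_over_n[of K]] by simp
  qed auto
  then have "(\<lambda>n. 4 * norm (?E n x) * norm (P x)) \<longlonglongrightarrow> 4 * 0 * norm (P x)"
    by (intro tendsto_mult_left tendsto_mult_right)
  then have "(\<lambda>n. 4 * norm (?E n x) * norm (P x)) \<longlonglongrightarrow> 0"
    by (simp only: mult_zero_right mult_zero_left)
  then have "(\<lambda>n. ip (?E n x) (P x)) \<longlonglongrightarrow> 0"
    by (rule Lim_null_comparison[rotated]) (simp add: norm_ip_le)
  then have "(\<lambda>n. ip (D x) (P x) - ip (?E n x) (P x)) \<longlonglongrightarrow> ip (D x) (P x) - 0"
    by (intro tendsto_intros)
  then have "positive_elem (ip (D x) (P x))"
    by (intro positive_elem_tendsto[where F = sequentially])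
      (use pos in \<open>auto simp: ip_diff_left intro!: always_eventually\<close>)
  then show "positive_elem (ip (P (D x)) x)" using P(1) by (simp add: symmetric_op_def)
qed

text \<open>The norm bound becomes an order bound by
  \<open>form_dominated_if_norm_dominated\<close>, and rescaling reduces to the contractive case.
  The factor 4 is the constant of \<open>norm_ip_le\<close>.\<close>

lemma positive_op_compose:
  assumes D: "symmetric_op D" "positive_op D" and bnd: "\<And>x. norm (D x) \<le> K * norm x" and K: "K > 0"
    and P: "symmetric_op P" "positive_op P" and comm: "\<And>x. P (D x) = D (P x)"
  shows "positive_op (\<lambda>x. P (D x))"
proof -
  have "ip (D x) x \<preceq> (4 * K) *\<^sub>R ip x x" for x
  proof (rule form_dominated_if_norm_dominated[where act = act and p = "\<lambda>y. ip y y"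
        and q = "\<lambda>y. ip (D y) y"])
    show "positive_elem (ip (D y) y)" for y using D(2) by (rule positive_opD)
    show "ip (D (act a y)) (act a y) = a * ip (D y) y * a\<^sup>\<star>" for a y
      by (simp add: symmetric_op_act[OF D(1)] ip_act_left ip_act_right mult.assoc)
    show "norm (ip (D y) y) \<le> 4 * K * norm (ip y y)" for y
    proof -
      have "norm (ip (D y) y) \<le> 4 * norm (D y) * norm y" by (rule norm_ip_le)
      also have "\<dots> \<le> 4 * (K * norm y) * norm y"
        by (intro mult_right_mono mult_left_mono bnd) auto
      finally show ?thesis by (simp add: norm_ip_self power2_eq_square mult.assoc)
    qed
  qed (use K in \<open>auto simp: ip_positive ip_act_act\<close>)
  then have le: "positive_elem ((4 * K) *\<^sub>R ip x x - ip (D x) x)" for x by (simp add: cstar_le_def)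
  define E where "E x = (1 / (4 * K)) *\<^sub>R D x" for x
  have "positive_op (\<lambda>x. P (E x))"
  proof (rule positive_op_compose_contraction[of E P])
    show "symmetric_op E"
      using D(1) by (simp add: symmetric_op_def E_def ip_scaleR_left ip_scaleR_right)
    show "positive_op E"
      using D(2) K by (simp add: positive_op_def E_def ip_scaleR_left positive_elem_scaleR)
    show "ip (E x) x \<preceq> ip x x" for x
      using positive_elem_scaleR[OF le[of x], of "1 / (4 * K)"] K
      by (simp add: cstar_le_def E_def ip_scaleR_left scaleR_diff_right)
    show "P (E x) = E (P x)" for x by (simp add: E_def symmetric_op_scaleR[OF P(1)] comm)
  qed (use P in auto)
  then have "positive_elem ((4 * K) *\<^sub>R ip (P (E x)) x)" for x
    using K by (simp add: positive_op_def positive_elem_scaleR)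
  then show ?thesis
    using K by (simp add: positive_op_def E_def symmetric_op_scaleR[OF P(1)] ip_scaleR_left)
qed

section \<open>Operators in \<open>GL_pos\<close>, adjoints and the frame terms\<close>

lemma GL_pos_symmetric:
  assumes C: "C \<in> GL_pos ip"
  shows "symmetric_op C"
proof -
  have add: "C (x + y) = C x + C y" and scale: "C (c *\<^sub>C x) = c *\<^sub>C C x" for c x y
    using C by (auto simp: GL_pos_def bounded_clinear_def linear_simps)
  \<comment> \<open>\<open>B\<close> measures the failure of symmetry. It vanishes on the diagonal
    because positive elements are self-adjoint; expanding it at \<open>x + y\<close> and at
    \<open>x + \<i> *\<^sub>C y\<close> kills the rest.\<close>
  define B where "B x y = ip (C x) y - ip x (C y)" for x y
  have diag: "B x x = 0" for x
    using C positive_elem_star[of "ip (C x) x"] by (simp add: B_def GL_pos_def ip_star)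
  have Badd: "B (x + y) (x + y) = B x x + B x y + B y x + B y y" for x y
    by (simp add: B_def add ip_add_left ip_add_right)
  have Bl: "B (c *\<^sub>C x) y = c *\<^sub>C B x y" and Br: "B x (c *\<^sub>C y) = cnj c *\<^sub>C B x y" for c x y
    by (simp_all add: B_def scale ip_scaleC_left ip_scaleC_right scaleC_diff_right)
  have "B x y = 0" for x y
  proof -
    have 1: "B x y + B y x = 0" using Badd[of x y] by (simp add: diag)
    have "- (\<i> *\<^sub>C B x y) + \<i> *\<^sub>C B y x = 0"
      using Badd[of x "\<i> *\<^sub>C y"] by (simp add: diag Bl Br scaleC_minus_left)
    then have "(- \<i>) *\<^sub>C (- (\<i> *\<^sub>C B x y) + \<i> *\<^sub>C B y x) = 0" by simp
    then have "B y x = B x y"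
      by (simp add: scaleC_add_right scaleC_minus_right scaleC_minus_left scaleC_diff_right
          scaleC_scaleC scaleC_one)
    with 1 have "2 *\<^sub>R B x y = 0" by (simp add: scaleR_2)
    then show ?thesis by simp
  qed
  then show ?thesis by (simp add: symmetric_op_def B_def)
qed

lemma GL_pos_positive: "C \<in> GL_pos ip \<Longrightarrow> positive_op C"
  by (simp add: GL_pos_def positive_op_def)

lemma GL_pos_bounded:
  assumes "C \<in> GL_pos ip"
  obtains K where "K > 0" "\<And>x. norm (C x) \<le> K * norm x"
proof -
  have "bounded_linear C" using assms by (simp add: GL_pos_def bounded_clinear_def)
  then show thesis using that bounded_linear.pos_bounded by (metis mult.commute)
qed

lemma ip_adjoint_op:
  assumes "adjointable ip T"
  shows "ip (T x) y = ip x (adjoint_op ip T y)"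
proof -
  obtain S where S: "\<And>x y. ip (T x) y = ip x (S y)"
    using assms by (auto simp: adjointable_def)
  have "adjoint_op ip T = S"
    unfolding adjoint_op_def
  proof (rule the_equality)
    show "S' = S" if "\<forall>x y. ip (T x) y = ip x (S' y)" for S'
      using that S by (intro ext ip_left_cancel) metis
  qed (simp add: S)
  then show ?thesis using S by simp
qed

text \<open>The term equals \<open>\<langle>T* T C C' x, x\<rangle>\<close>, a product of three commuting positive operators.\<close>

lemma controlled_term_positive:
  assumes C: "C \<in> GL_pos ip" and C': "C' \<in> GL_pos ip" and T: "adjointable ip T"
    and CC': "C \<circ> C' = C' \<circ> C"
    and CP: "C \<circ> (adjoint_op ip T \<circ> T) = (adjoint_op ip T \<circ> T) \<circ> C"
    and C'P: "C' \<circ> (adjoint_op ip T \<circ> T) = (adjoint_op ip T \<circ> T) \<circ> C'"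
  shows "positive_elem (ip (T (C x)) (T (C' x)))"
proof -
  define P where "P = adjoint_op ip T \<circ> T"
  have TT: "ip (T u) (T v) = ip u (P v)" for u v
    using ip_adjoint_op[OF T] by (simp add: P_def)
  have TT': "ip (P u) v = ip (T u) (T v)" for u v
    by (metis TT ip_star)
  have P: "symmetric_op P" "positive_op P"
    by (simp_all add: symmetric_op_def positive_op_def TT' ip_positive TT[symmetric])
  have comm: "C (C' y) = C' (C y)" "C (P y) = P (C y)" "C' (P y) = P (C' y)" for y
    using CC' CP C'P by (auto simp: P_def fun_eq_iff)
  obtain K where K: "K > 0" "\<And>x. norm (C x) \<le> K * norm x" using GL_pos_bounded[OF C] by blast
  obtain K' where K': "K' > 0" "\<And>x. norm (C' x) \<le> K' * norm x" using GL_pos_bounded[OF C'] by blast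
  note sC = symmetric_opD[OF GL_pos_symmetric[OF C]] and sP = symmetric_opD[OF P(1)]
  have "positive_op (\<lambda>y. P (C y))"
    using C P K by (intro positive_op_compose[of C K P]) (simp_all add: GL_pos_symmetric GL_pos_positive comm)
  \<comment> \<open>Commutation keeps the product symmetric, so the composition lemma applies again
    with \<open>C'\<close> as the next factor.\<close>
  moreover have "symmetric_op (\<lambda>y. P (C y))"
    by (simp add: symmetric_op_def sC sP comm)
  ultimately have "positive_op (\<lambda>y. P (C (C' y)))"
    using C' K' by (intro positive_op_compose[of C' K' "\<lambda>y. P (C y)"])
      (simp_all add: GL_pos_symmetric GL_pos_positive comm)
  then have pos: "positive_elem (ip (P (C (C' x))) x)" by (rule positive_opD)
  have "ip (T (C x)) (T (C' x)) = ip x (P (C (C' x)))" by (simp add: TT sC comm)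
  also have "\<dots> = ip (P (C (C' x))) x" using positive_elem_star[OF pos] by (simp add: ip_star)
  finally show ?thesis using pos by simp
qed

end

subsection \<open>Controlled frames\<close>

lemma positive_elem_has_sum:
  fixes f :: "'i \<Rightarrow> 'a::cstar_algebra"
  assumes "(f has_sum s) I" "\<And>i. i \<in> I \<Longrightarrow> positive_elem (f i)"
  shows "positive_elem s"
  using assms(1) unfolding has_sum_def
proof (rule positive_elem_tendsto)
  show "\<forall>\<^sub>F F in finite_subsets_at_top I. positive_elem (sum f F)"
    using assms(2) by (intro eventually_finite_subsets_at_top_weakI positive_elem_sum) auto
qed simp

lemma strictly_nonzero_iff_invertible: "strictly_nonzero a \<longleftrightarrow> invertible_elem a"
  by (simp add: strictly_nonzero_def invertible_iff_spectrum)

context hilbert_module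
begin

section \<open>Passage between order bounds and norm bounds\<close>

lemma norm_bounds_if_order_bounds:
  assumes A: "invertible_elem A"
    and lower: "A * ip x x * A\<^sup>\<star> \<preceq> s" and upper: "s \<preceq> B * ip x x * B\<^sup>\<star>"
  shows "norm (elem_inverse A) powi (-2) * norm (ip x x) \<le> norm s"
    and "norm s \<le> (norm B)\<^sup>2 * norm (ip x x)"
proof -
  let ?i = "elem_inverse A"
  have pA: "positive_elem (A * ip x x * A\<^sup>\<star>)" using ip_positive[of "act A x"] by (simp add: ip_act_act)
  have s: "positive_elem s"
    using positive_elem_add[OF pA, of "s - A * ip x x * A\<^sup>\<star>"] lower by (simp add: cstar_le_def)
  \<comment> \<open>Recovering \<open>ip x x\<close> by conjugation with the inverse of
    \<open>A\<close> costs the factor \<open>(norm ?i)\<^sup>2\<close>, whence the exponent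
    -2.\<close>
  have "?i * (A * ip x x * A\<^sup>\<star>) * ?i\<^sup>\<star> = (?i * A) * ip x x * (?i * A)\<^sup>\<star>"
    by (simp add: star_mult mult.assoc)
  then have "ip x x = ?i * (A * ip x x * A\<^sup>\<star>) * ?i\<^sup>\<star>" by (simp add: elem_inverse_left[OF A])
  then have "norm (ip x x) \<le> norm (?i * (A * ip x x * A\<^sup>\<star>)) * norm (?i\<^sup>\<star>)"
    by (metis norm_mult_ineq)
  also have "\<dots> \<le> (norm ?i * norm (A * ip x x * A\<^sup>\<star>)) * norm ?i"
    unfolding norm_star by (intro mult_right_mono norm_mult_ineq) simp
  also have "\<dots> \<le> (norm ?i * norm s) * norm ?i"
    using norm_mono_positive[OF pA lower] by (intro mult_right_mono mult_left_mono) auto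
  finally have "norm (ip x x) \<le> (norm ?i)\<^sup>2 * norm s" by (simp add: power2_eq_square mult_ac)
  then show "norm ?i powi (-2) * norm (ip x x) \<le> norm s"
    using elem_inverse_nonzero[OF A] by (simp add: power_int_minus field_simps)
  have "norm s \<le> norm (B * ip x x * B\<^sup>\<star>)" using s upper by (rule norm_mono_positive)
  also have "\<dots> \<le> norm (B * ip x x) * norm (B\<^sup>\<star>)" by (rule norm_mult_ineq)
  also have "\<dots> \<le> (norm B * norm (ip x x)) * norm B"
    unfolding norm_star by (intro mult_right_mono norm_mult_ineq) simp
  finally show "norm s \<le> (norm B)\<^sup>2 * norm (ip x x)" by (simp add: power2_eq_square mult_ac)
qed

lemma order_bounds_if_norm_bounds:
  assumes s: "\<And>x. positive_elem (s x)" and s_act: "\<And>a x. s (act a x) = a * s x * a\<^sup>\<star>"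
    and m: "m > 0" and M: "M \<ge> 0"
    and lower: "\<And>x. m * norm (ip x x) \<le> norm (s x)" and upper: "\<And>x. norm (s x) \<le> M * norm (ip x x)"
  shows "m *\<^sub>R ip x x \<preceq> s x" and "s x \<preceq> M *\<^sub>R ip x x"
proof -
  show "s x \<preceq> M *\<^sub>R ip x x"
    by (rule form_dominated_if_norm_dominated[where act = act and p = "\<lambda>x. ip x x" and q = s])
      (use assms in \<open>auto simp: ip_positive ip_act_act\<close>)
  \<comment> \<open>For the lower bound \<open>ip\<close> and \<open>s\<close> exchange roles, with
    constant \<open>1 / m\<close>.\<close>
  have "norm (ip x x) \<le> (1 / m) * norm (s x)" for x
    using lower[of x] m by (simp add: field_simps)
  then have "ip x x \<preceq> (1 / m) *\<^sub>R s x"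
    by (intro form_dominated_if_norm_dominated[where act = act and q = "\<lambda>x. ip x x" and p = s])
      (use s s_act m in \<open>auto simp: ip_positive ip_act_act\<close>)
  then have "positive_elem (m *\<^sub>R ((1 / m) *\<^sub>R s x - ip x x))"
    using m by (simp add: cstar_le_def positive_elem_scaleR)
  then show "m *\<^sub>R ip x x \<preceq> s x" using m by (simp add: cstar_le_def scaleR_diff_right)
qed

text \<open>\<open>C\<close>, \<open>C'\<close> and each \<open>T i\<close> are module linear
  through their adjoints, so \<open>a\<close> comes out of every term on both sides, and then out of
  the sum.\<close>

lemma controlled_sum_act:
  assumes C: "C \<in> GL_pos ip" and C': "C' \<in> GL_pos ip"
    and T: "\<And>i. i \<in> I \<Longrightarrow> adjointable ip (T i)"
    and sum: "(\<lambda>i. ip (T i (C x)) (T i (C' x))) summable_on I"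
  shows "(\<Sum>\<^sub>\<infinity>i\<in>I. ip (T i (C (act a x))) (T i (C' (act a x))))
    = a * (\<Sum>\<^sub>\<infinity>i\<in>I. ip (T i (C x)) (T i (C' x))) * a\<^sup>\<star>"
proof -
  have "ip (T i (C (act a x))) (T i (C' (act a x))) = a * ip (T i (C x)) (T i (C' x)) * a\<^sup>\<star>"
    if i: "i \<in> I" for i
    using C C' by (simp add: symmetric_op_act GL_pos_symmetric
        adjoint_imp_act[OF ip_adjoint_op[OF T[OF i]]] ip_act_left ip_act_right mult.assoc)
  then have "(\<Sum>\<^sub>\<infinity>i\<in>I. ip (T i (C (act a x))) (T i (C' (act a x))))
      = (\<Sum>\<^sub>\<infinity>i\<in>I. a * ip (T i (C x)) (T i (C' x)) * a\<^sup>\<star>)"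
    by (rule infsum_cong)
  also have "\<dots> = a * (\<Sum>\<^sub>\<infinity>i\<in>I. ip (T i (C x)) (T i (C' x))) * a\<^sup>\<star>"
    by (intro infsumI has_sum_cmult_left has_sum_cmult_right has_sum_infsum sum)
  finally show ?thesis .
qed

end

theorem theorem2p8:
  fixes act :: "'a::cstar_algebra \<Rightarrow> 'h::complex_banach \<Rightarrow> 'h"
    and ip :: "'h \<Rightarrow> 'h \<Rightarrow> 'a"
    and C C' :: "'h \<Rightarrow> 'h"
    and I :: "'i set"
    and T :: "'i \<Rightarrow> 'h \<Rightarrow> 'h"
  assumes "hilbert_module act ip"
    and "C \<in> GL_pos ip" and "C' \<in> GL_pos ip"
    and "countable I"
    and "\<And>i. i \<in> I \<Longrightarrow> adjointable ip (T i)"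
    and "C \<circ> C' = C' \<circ> C"
    and "\<And>i. i \<in> I \<Longrightarrow> C \<circ> (adjoint_op ip (T i) \<circ> T i) = (adjoint_op ip (T i) \<circ> T i) \<circ> C"
    and "\<And>i. i \<in> I \<Longrightarrow> C' \<circ> (adjoint_op ip (T i) \<circ> T i) = (adjoint_op ip (T i) \<circ> T i) \<circ> C'"
    and "\<And>x. (\<lambda>i. ip (T i (C x)) (T i (C' x))) summable_on I"
  shows "controlled_star_operator_frame ip C C' I T \<longleftrightarrow>
    (\<exists>(A :: 'a) (B :: 'a). strictly_nonzero A \<and> strictly_nonzero B \<and>
      (\<forall>x. norm (elem_inverse A) powi (-2) * norm (ip x x)
             \<le> norm (\<Sum>\<^sub>\<infinity>i\<in>I. ip (T i (C x)) (T i (C' x))) \<and>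
           norm (\<Sum>\<^sub>\<infinity>i\<in>I. ip (T i (C x)) (T i (C' x))) \<le> (norm B)\<^sup>2 * norm (ip x x)))"
    (is "?frame \<longleftrightarrow> ?bounds")
proof -
  interpret hilbert_module act ip by fact
  define s where "s x = (\<Sum>\<^sub>\<infinity>i\<in>I. ip (T i (C x)) (T i (C' x)))" for x
  show ?thesis
  proof
    assume ?frame
    then obtain A B :: 'a where AB: "invertible_elem A" "invertible_elem B"
      and bounds: "\<And>x. A * ip x x * A\<^sup>\<star> \<preceq> s x" "\<And>x. s x \<preceq> B * ip x x * B\<^sup>\<star>"
      unfolding controlled_star_operator_frame_def controlled_frame_bounds_def s_def by blast
    show ?bounds
      unfolding strictly_nonzero_iff_invertible s_def[symmetric]
      using AB norm_bounds_if_order_bounds[OF AB(1) bounds] by blast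
  next
    assume ?bounds
    then obtain A B :: 'a where AB: "invertible_elem A" "invertible_elem B"
      and lower: "\<And>x. norm (elem_inverse A) powi (-2) * norm (ip x x) \<le> norm (s x)"
      and upper: "\<And>x. norm (s x) \<le> (norm B)\<^sup>2 * norm (ip x x)"
      unfolding strictly_nonzero_iff_invertible s_def[symmetric] by blast
    define m where "m = norm (elem_inverse A) powi (-2)"
    have m: "m > 0" using elem_inverse_nonzero[OF AB(1)] by (simp add: m_def)
    have "B \<noteq> 0" using elem_inverse_right[OF AB(2)] by auto
    then have B: "norm B > 0" by simp
    have s: "positive_elem (s x)" for x
      unfolding s_def using has_sum_infsum[OF assms(9)]
      by (rule positive_elem_has_sum) (intro controlled_term_positive assms)
    have s_act: "s (act a x) = a * s x * a\<^sup>\<star>" for a x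
      unfolding s_def by (intro controlled_sum_act assms)
    note bounds = order_bounds_if_norm_bounds[OF s s_act m zero_le_power2 lower[folded m_def] upper]
    \<comment> \<open>Scalars serve as frame bounds. A bound enters twice, so its square must be the
      norm constant: hence \<open>sqrt m\<close> below and \<open>norm B\<close> above.\<close>
    have scalar: "(r *\<^sub>R 1) * ip x x * (r *\<^sub>R 1)\<^sup>\<star> = r\<^sup>2 *\<^sub>R ip x x" for r x
      by (simp add: star_scaleR power2_eq_square)
    have pos: "positive_elem (r *\<^sub>R (1::'a)) \<and> invertible_elem (r *\<^sub>R (1::'a))" if "r > 0" for r
      unfolding scaleR_scaleC using that
      by (auto intro!: invertible_scaleC invertible_elemI[of 1 1]
          positive_elem_scaleR[OF positive_elem_one, unfolded scaleR_scaleC])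
    have "controlled_frame_bounds ip C C' I T (sqrt m *\<^sub>R 1) (norm B *\<^sub>R 1)"
      unfolding controlled_frame_bounds_def s_def[symmetric] scalar using bounds m by simp
    then show ?frame
      unfolding controlled_star_operator_frame_def
      using assms(2,3,5,9) pos[of "sqrt m"] pos[OF B] m by auto
  qed
qed

end
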